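(* Let $\mathfrak{t}$ be a closed nonnegative symmetric form with dense domain $\mathcal{D}$ in the real or complex Hilbert space $\mathcal{H}$. Then there exists a unique positive self-adjoint operator $T$ in $\mathcal{H}$ satisfying the following properties: (a) $\operatorname{dom}T\subseteq\mathcal{D}$ and $\mathfrak{t}(g,h)=(Tg,h)$ for all $g\in\operatorname{dom}T$ and $h\in\mathcal{D}$; (b) $\mathcal{D}=\operatorname{dom}T^{1/2}$ and $\mathfrak{t}(g,h)=(T^{1/2}g,T^{1/2}h)$ for all $g,h\in\mathcal{D}$.
   Context: $(\cdot,\cdot)$ is the inner product of $\mathcal{H}$, linear in the first variable. A nonnegative (also called positive) symmetric form $\mathfrak{t}$ on a linear subspace $\mathcal{D}\subseteq\mathcal{H}$ is a semi-inner product on $\mathcal{D}$: sesquilinear (bilinear in the real case), linear in the first variable, $\mathfrak{t}(g,h)=\overline{\mathfrak{t}(h,g)}$, $\mathfrak{t}(g,g)\ge0$. The form $\mathfrak{t}$ is closed if for every sequence $(g_n)$ in $\mathcal{D}$, the conditions $g_n\to g$ in $\mathcal{H}$ and $\mathfrak{t}(g_n-g_m,g_n-g_m)\to0$ as $n,m\to\infty$ imply $g\in\mathcal{D}$ and $\mathfrak{t}(g_n-g,g_n-g)\to0$. An operator $T$ is positive if $(Tg,g)\ge0$ for all $g\in\operatorname{dom}T$; operators may be unbounded. $T^{1/2}$ denotes the unique positive self-adjoint square root of a positive self-adjoint operator $T$. *)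

theory Defs
  imports "HOL-Analysis.Analysis"
begin

text \<open>
  The scalar field. The axioms force \<open>'a\<close> to be the reals with the identity or the complex numbers
  with complex conjugation (up to isometric isomorphism), so that quantifying over this class means
  ``real or complex''.
\<close>

class real_or_complex = real_normed_field +
  fixes conjg :: "'a \<Rightarrow> 'a"
  assumes conjg_add: "conjg (x + y) = conjg x + conjg y"
    and conjg_mult: "conjg (x * y) = conjg x * conjg y"
    and conjg_scaleR: "conjg (r *\<^sub>R x) = r *\<^sub>R conjg x"
    and mult_conjg: "x * conjg x = (norm x)\<^sup>2 *\<^sub>R 1"

instantiation real :: real_or_complex
begin
definition conjg_real :: "real \<Rightarrow> real" where "conjg_real x = x"
instance by standard (auto simp: conjg_real_def power2_eq_square)
end

instantiation complex :: real_or_complex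
begin
definition conjg_complex :: "complex \<Rightarrow> complex" where "conjg_complex = cnj"
instance
  by standard
    (auto simp: conjg_complex_def complex_mult_cnj cmod_power2 scaleR_conv_of_real)
end

text \<open>
  A Hilbert space over the scalars \<open>'k\<close>: the type \<open>'h\<close> carries the underlying real Hilbert space
  (hence norm, topology and completeness), and the locale adds a scalar multiplication by \<open>'k\<close> and a
  \<open>'k\<close>-valued inner product inducing the same norm. For \<open>'k = real\<close> these are necessarily the
  operations \<^const>\<open>scaleR\<close> and \<^const>\<open>inner\<close>; for \<open>'k = complex\<close>, \<^const>\<open>inner\<close> is necessarily the
  real part of \<open>ip\<close>.
\<close>

locale hilbert_space = vector_space smul
  for smul :: "'k::real_or_complex \<Rightarrow> 'h::{real_inner,complete_space} \<Rightarrow> 'h" +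
  fixes ip :: "'h \<Rightarrow> 'h \<Rightarrow> 'k"
  assumes scale_of_real: "smul (of_real r) x = r *\<^sub>R x"
    and ip_add_left: "ip (x + y) z = ip x z + ip y z"
    and ip_scale_left: "ip (smul c x) y = c * ip x y"
    and ip_commute: "ip x y = conjg (ip y x)"
    and ip_self: "ip x x = of_real ((norm x)\<^sup>2)"

lemma hilbert_space_real:
  "hilbert_space (scaleR :: real \<Rightarrow> 'h::{real_inner,complete_space} \<Rightarrow> 'h) inner"
  by unfold_locales
    (auto simp: algebra_simps inner_add_left conjg_real_def inner_commute power2_norm_eq_inner)

lemma hilbert_space_complex:
  "hilbert_space ((*) :: complex \<Rightarrow> complex \<Rightarrow> complex) (\<lambda>x y. x * cnj y)"
  by unfold_locales
    (auto simp: algebra_simps conjg_complex_def complex_mult_cnj cmod_power2 scaleR_conv_of_real)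

text \<open>Conjugate linearity in the second variable follows from the Hermitian symmetry.\<close>

definition nonneg_symmetric_form ::
  "('k::real_or_complex \<Rightarrow> 'h::{real_inner,complete_space} \<Rightarrow> 'h) \<Rightarrow> 'h set \<Rightarrow> ('h \<Rightarrow> 'h \<Rightarrow> 'k) \<Rightarrow> bool"
  where
  "nonneg_symmetric_form smul D t \<longleftrightarrow>
     module.subspace smul D \<and>
     (\<forall>f\<in>D. \<forall>g\<in>D. \<forall>h\<in>D. t (f + g) h = t f h + t g h) \<and>
     (\<forall>c. \<forall>g\<in>D. \<forall>h\<in>D. t (smul c g) h = c * t g h) \<and>
     (\<forall>g\<in>D. \<forall>h\<in>D. t g h = conjg (t h g)) \<and>
     (\<forall>g\<in>D. t g g \<in> \<real>\<^sub>\<ge>\<^sub>0)"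

definition closed_form ::
  "'h::{real_inner,complete_space} set \<Rightarrow> ('h \<Rightarrow> 'h \<Rightarrow> 'k::real_or_complex) \<Rightarrow> bool"
  where
  "closed_form D t \<longleftrightarrow>
     (\<forall>gs g. (\<forall>n. gs n \<in> D) \<longrightarrow> gs \<longlonglongrightarrow> g \<longrightarrow>
        ((\<lambda>(n, m). t (gs n - gs m) (gs n - gs m)) \<longlongrightarrow> 0) (sequentially \<times>\<^sub>F sequentially) \<longrightarrow>
        g \<in> D \<and> (\<lambda>n. t (gs n - g) (gs n - g)) \<longlonglongrightarrow> 0)"

text \<open>
  Unbounded operators are partial maps \<open>'h \<rightharpoonup> 'h\<close>, so that \<^const>\<open>dom\<close> is the domain of the operator,
  equality of operators includes equality of domains, and \<open>S \<circ>\<^sub>m S\<close> is the operator product with its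
  natural domain, the set of all \<open>x\<close> in \<open>dom S\<close> with \<open>S x\<close> in \<open>dom S\<close>.
\<close>

definition linear_operator ::
  "('k::real_or_complex \<Rightarrow> 'h::{real_inner,complete_space} \<Rightarrow> 'h) \<Rightarrow> ('h \<rightharpoonup> 'h) \<Rightarrow> bool"
  where
  "linear_operator smul T \<longleftrightarrow>
     module.subspace smul (dom T) \<and>
     (\<forall>x\<in>dom T. \<forall>y\<in>dom T. the (T (x + y)) = the (T x) + the (T y)) \<and>
     (\<forall>c. \<forall>x\<in>dom T. the (T (smul c x)) = smul c (the (T x)))"

text \<open>
  The vector \<open>z\<close> is unique if \<open>T\<close> is densely defined; the adjoint is only used in that case.
\<close>

definition adjoint_operator ::
  "('h::{real_inner,complete_space} \<Rightarrow> 'h \<Rightarrow> 'k::real_or_complex) \<Rightarrow> ('h \<rightharpoonup> 'h) \<Rightarrow> ('h \<rightharpoonup> 'h)"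
  where
  "adjoint_operator ip T =
     (\<lambda>y. if \<exists>z. \<forall>x\<in>dom T. ip (the (T x)) y = ip x z
          then Some (THE z. \<forall>x\<in>dom T. ip (the (T x)) y = ip x z)
          else None)"

definition self_adjoint ::
  "('k::real_or_complex \<Rightarrow> 'h::{real_inner,complete_space} \<Rightarrow> 'h) \<Rightarrow> ('h \<Rightarrow> 'h \<Rightarrow> 'k) \<Rightarrow>
   ('h \<rightharpoonup> 'h) \<Rightarrow> bool"
  where
  "self_adjoint smul ip T \<longleftrightarrow>
     linear_operator smul T \<and> closure (dom T) = UNIV \<and> adjoint_operator ip T = T"

definition positive_operator ::
  "('h::{real_inner,complete_space} \<Rightarrow> 'h \<Rightarrow> 'k::real_or_complex) \<Rightarrow> ('h \<rightharpoonup> 'h) \<Rightarrow> bool"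
  where
  "positive_operator ip T \<longleftrightarrow> (\<forall>g\<in>dom T. ip (the (T g)) g \<in> \<real>\<^sub>\<ge>\<^sub>0)"

definition sqrt_operator ::
  "('k::real_or_complex \<Rightarrow> 'h::{real_inner,complete_space} \<Rightarrow> 'h) \<Rightarrow> ('h \<Rightarrow> 'h \<Rightarrow> 'k) \<Rightarrow>
   ('h \<rightharpoonup> 'h) \<Rightarrow> ('h \<rightharpoonup> 'h)"
  where
  "sqrt_operator smul ip T =
     (THE S. self_adjoint smul ip S \<and> positive_operator ip S \<and> S \<circ>\<^sub>m S = T)"

end

theory Submission
  imports Defs
begin

text \<open>
  On \<open>D\<close> the energy product \<open>t(g,h) + (g,h)\<close> is a complete inner product, because \<open>t\<close> is closed.
  The Riesz argument applied to \<open>h \<mapsto> (v,h)\<close> gives \<open>B v \<in> D\<close> with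
  \<open>t(B v,h) + (B v,h) = (v,h)\<close> for all \<open>h \<in> D\<close>. The map \<open>B\<close> is an injective positive contraction, and
  an operator \<open>T\<close> can represent \<open>t\<close> only if \<open>B\<close> is its resolvent \<open>(1 + T)\<^sup>-\<^sup>1\<close>. Hence
  \<open>T\<close> has to be \<open>B v \<mapsto> v - B v\<close>, and uniqueness reduces to the fact that a self-adjoint operator has
  no proper self-adjoint extension.

  No spectral theorem for the unbounded \<open>T\<close> is used; square roots of positive contractions suffice.
  Put \<open>P = B\<^sup>1\<^sup>/\<^sup>2\<close> and \<open>Q = (1 - B)\<^sup>1\<^sup>/\<^sup>2\<close>. These commute and satisfy \<open>P\<^sup>2 + Q\<^sup>2 = 1\<close>, so
  \<open>x \<mapsto> (P x, Q x)\<close> is an isometry of \<open>H\<close> onto the graph of an operator \<open>S = Q P\<^sup>-\<^sup>1\<close>. Self-adjointness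
  of \<open>S\<close> and \<open>S S = T\<close> both follow from one algebraic remark: \<open>Q y = P z\<close> forces \<open>y = P w\<close> and
  \<open>z = Q w\<close>, with \<open>w = P y + Q z\<close> (lemma \<open>factor_PQ\<close>). Positivity of \<open>S\<close> is positivity of
  a product of commuting positive operators.

  That \<open>S\<close> is the only positive self-adjoint root of \<open>T\<close> (lemma \<open>S_unique\<close>) is again reduced to
  bounded operators. For any such root \<open>S'\<close>, the everywhere defined operator \<open>S' B\<close> is a positive
  contraction with the same square as \<open>P Q = S B\<close> and commutes with it, so the two agree; as \<open>S'\<close> is
  closed it extends \<open>S\<close>, hence equals it.

  Finally \<open>D\<close> is the range of \<open>P\<close>, that is, the domain of \<open>S\<close>. If \<open>g \<in> D\<close>, then the Cauchy-Schwarz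
  inequality for the energy product bounds \<open>\<bar>(v,g)\<bar>\<close> by a multiple of \<open>\<parallel>P v\<parallel>\<close>, which puts \<open>g\<close> in the
  range of \<open>P\<close> (lemma \<open>range_if_bounded\<close>). Conversely \<open>B = P P\<close> maps \<open>H\<close> into \<open>D\<close>, the energy of
  \<open>P (P w)\<close> is \<open>\<parallel>P w\<parallel>\<^sup>2\<close>, and the vectors \<open>P w\<close> are dense, so closedness gives \<open>P x \<in> D\<close> for every
  \<open>x\<close>. The same limit yields \<open>t(P x,P y) + (P x,P y) = (x,y)\<close>, and subtracting \<open>(P x,P y)\<close> leaves
  \<open>(Q x,Q y) = (S P x,S P y)\<close>.

  All of this is carried out in the underlying real Hilbert space, with the real parts of \<open>t\<close> and of
  the inner product. The scalars return at the end: \<open>B\<close> commutes with scalar multiplication, hence so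
  do \<open>P\<close> and \<open>Q\<close>, and a scalar \<open>w\<close> is determined by the real parts of all its multiples.
\<close>

section \<open>Real parts of scalars\<close>

text \<open>
  Polarisation expresses the real part through the norm, the only real-valued
  function that the class of scalars provides.
\<close>

definition re :: "'k::real_or_complex \<Rightarrow> real" where
  "re w = ((norm (w + 1))\<^sup>2 - (norm w)\<^sup>2 - 1) / 2"

lemma conjg_1 [simp]: "conjg (1 :: 'k::real_or_complex) = 1"
  using mult_conjg[of "1::'k"] by simp

lemma mult_conjg_of_real: "x * conjg x = of_real ((norm x)\<^sup>2)" for x :: "'k::real_or_complex"
  by (simp add: mult_conjg of_real_def)

lemma of_real_re: "of_real (2 * re w) = w + conjg w" for w :: "'k::real_or_complex"
proof -
  have "of_real ((norm (w + 1))\<^sup>2) = (w + 1) * (conjg w + 1)"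
    by (metis mult_conjg_of_real conjg_add conjg_1)
  also have "\<dots> = of_real ((norm w)\<^sup>2) + w + conjg w + 1"
    by (simp add: algebra_simps mult_conjg_of_real del: of_real_power)
  finally show ?thesis by (simp add: re_def)
qed

lemma conjg_of_real [simp]: "conjg (of_real r :: 'k::real_or_complex) = of_real r"
  by (simp add: of_real_def conjg_scaleR)

lemma re_eqI: "w + conjg w = of_real (2 * r) \<Longrightarrow> re w = r" for w :: "'k::real_or_complex"
  by (metis of_real_re of_real_eq_iff mult_cancel_left zero_neq_numeral)

lemma re_of_real [simp]: "re (of_real r :: 'k::real_or_complex) = r"
  by (rule re_eqI) simp

lemma re_add: "re (v + w) = re v + re w" for v w :: "'k::real_or_complex"
proof (rule re_eqI)
  have "(v + w) + conjg (v + w) = (v + conjg v) + (w + conjg w)" by (simp add: conjg_add)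
  also have "\<dots> = of_real (2 * re v) + of_real (2 * re w)" by (simp only: of_real_re)
  finally show "(v + w) + conjg (v + w) = of_real (2 * (re v + re w))" by simp
qed

lemma re_of_real_mult: "re (of_real r * w) = r * re w" for w :: "'k::real_or_complex"
proof (rule re_eqI)
  have "of_real r * w + conjg (of_real r * w) = of_real r * (w + conjg w)"
    by (simp add: conjg_mult algebra_simps)
  also have "\<dots> = of_real r * of_real (2 * re w)" by (simp only: of_real_re)
  finally show "of_real r * w + conjg (of_real r * w) = of_real (2 * (r * re w))" by simp
qed

lemma re_diff: "re (v - w) = re v - re w" for v w :: "'k::real_or_complex"
  using re_add[of "v - w" w] by simp

lemma conjg_conjg [simp]: "conjg (conjg w) = w" for w :: "'k::real_or_complex"
proof -
  have "conjg w = of_real (2 * re w) - w" by (simp only: of_real_re add_diff_cancel_left')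
  then have "conjg (conjg w) + conjg w = of_real (2 * re w)"
    by (metis conjg_add conjg_of_real diff_add_cancel add.commute)
  then show ?thesis by (metis of_real_re add_right_imp_eq)
qed

lemma re_conjg [simp]: "re (conjg w) = re w" for w :: "'k::real_or_complex"
  by (rule re_eqI) (simp add: of_real_re add.commute del: of_real_mult)

lemma of_real_re_self_conjugate: "conjg w = w \<Longrightarrow> of_real (re w) = w" for w :: "'k::real_or_complex"
  using of_real_re[of w] by simp

text \<open>
  Taking \<open>c\<close> to be the conjugate of the difference turns its real part into a squared norm.
\<close>

lemma scalar_eq_via_re:
  fixes v w :: "'k::real_or_complex"
  assumes "\<And>c. re (c * v) = re (c * w)"
  shows "v = w"
proof -
  have "re (conjg (v - w) * (v - w)) = 0"
    using assms[of "conjg (v - w)"] by (simp add: right_diff_distrib re_diff)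
  then have "re (of_real ((norm (v - w))\<^sup>2) :: 'k) = 0"
    by (metis mult_conjg_of_real mult.commute)
  then show ?thesis
    unfolding re_of_real by simp
qed

lemma nonneg_Reals_iff_re:
  "w \<in> \<real>\<^sub>\<ge>\<^sub>0 \<longleftrightarrow> conjg w = w \<and> 0 \<le> re w" for w :: "'k::real_or_complex"
  by (metis conjg_of_real nonneg_Reals_cases nonneg_Reals_of_real_iff of_real_re_self_conjugate re_of_real)

section \<open>Passing to the underlying real Hilbert space\<close>

lemma orthogonal_dense:
  fixes y :: "'v::real_inner"
  assumes "closure V = UNIV" "\<And>x. x \<in> V \<Longrightarrow> inner x y = 0"
  shows "y = 0"
proof -
  have "closed {x. inner x y = 0}" by (intro closed_Collect_eq continuous_intros)
  then have "closure V \<subseteq> {x. inner x y = 0}" using assms by (intro closure_minimal) auto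
  then have "y \<in> {x. inner x y = 0}" using assms(1) by blast
  then show ?thesis by simp
qed

context hilbert_space
begin

lemma ip_add_right: "ip x (y + z) = ip x y + ip x z"
  by (metis ip_add_left ip_commute conjg_add)

lemma re_ip: "re (ip x y) = inner x y"
proof (rule re_eqI)
  have "of_real ((norm (x + y))\<^sup>2) = ip x x + ip y y + (ip x y + conjg (ip x y))"
    unfolding ip_self[symmetric] ip_add_left ip_add_right
    by (simp add: algebra_simps flip: ip_commute[of y x])
  also have "(norm (x + y))\<^sup>2 = (norm x)\<^sup>2 + (norm y)\<^sup>2 + 2 * inner x y"
    by (simp add: power2_norm_eq_inner inner_add inner_commute)
  finally show "ip x y + conjg (ip x y) = of_real (2 * inner x y)"
    by (simp add: ip_self)
qed

lemma re_scale_ip: "re (c * ip x y) = inner (smul c x) y"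
  by (metis ip_scale_left re_ip)

lemma inner_scale_left: "inner (smul c x) y = inner x (smul (conjg c) y)"
proof -
  have "ip x (smul (conjg c) y) = conjg (ip (smul (conjg c) y) x)" by (rule ip_commute)
  also have "\<dots> = c * ip x y" by (metis ip_scale_left conjg_mult conjg_conjg ip_commute)
  finally have "ip (smul c x) y = ip x (smul (conjg c) y)" by (simp add: ip_scale_left)
  then show ?thesis by (metis re_ip)
qed

lemma bounded_linear_scale: "bounded_linear (smul c)"
proof (rule bounded_linear_intro)
  show "smul c (r *\<^sub>R x) = r *\<^sub>R smul c x" for r x
    by (metis scale_of_real scale_left_commute)
  show "norm (smul c x) \<le> norm x * norm c" for x
  proof -
    have "(norm (smul c x))\<^sup>2 = inner (smul c x) (smul c x)" by (rule power2_norm_eq_inner)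
    also have "\<dots> = inner x (smul (conjg c * c) x)" by (simp add: inner_scale_left)
    also have "conjg c * c = of_real ((norm c)\<^sup>2)" by (metis mult.commute mult_conjg_of_real)
    also have "inner x (smul (of_real ((norm c)\<^sup>2)) x) = (norm x * norm c)\<^sup>2"
      by (simp only: scale_of_real) (simp add: power_mult_distrib power2_norm_eq_inner)
    finally show ?thesis by (simp add: power2_eq_imp_eq)
  qed
qed (rule scale_right_distrib)

lemma subspace_imp_real: "subspace V \<Longrightarrow> real_vector.subspace V"
  unfolding real_vector.subspace_def subspace_def by (simp flip: scale_of_real)

lemma linear_operator_imp_real: "linear_operator smul T \<Longrightarrow> linear_operator scaleR T"
  unfolding linear_operator_def subspace_raw_def[symmetric] using subspace_imp_real
  by (simp flip: scale_of_real)

text \<open>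
  This equivalence makes it possible to replace \<open>ip\<close> by \<open>inner\<close> whenever the first argument
  ranges over a set that is stable under scalar multiplication.
\<close>

lemma ip_eq_iff: "ip u v = ip u' v' \<longleftrightarrow> (\<forall>c. inner (smul c u) v = inner (smul c u') v')"
  unfolding re_scale_ip[symmetric] by (auto intro: scalar_eq_via_re)

text \<open>
  The operator \<open>T\<close> is linear over the scalars, so the adjoint relation tested with \<open>smul c x\<close> for all
  \<open>c\<close> is the same for \<open>ip\<close> and for its real part. Density makes the vector in the definition of the
  adjoint unique, and the adjoint disappears from the characterisation.
\<close>

lemma self_adjoint_iff_inner:
  "self_adjoint smul ip T \<longleftrightarrow> linear_operator smul T \<and> closure (dom T) = UNIV \<and>
     (\<forall>y z. T y = Some z \<longleftrightarrow> (\<forall>x\<in>dom T. inner (the (T x)) y = inner x z))"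
proof (cases "linear_operator smul T \<and> closure (dom T) = UNIV")
  case True
  define P where "P y z \<longleftrightarrow> (\<forall>x\<in>dom T. ip (the (T x)) y = ip x z)" for y z
  have P_inner: "P y z \<longleftrightarrow> (\<forall>x\<in>dom T. inner (the (T x)) y = inner x z)" for y z
  proof
    assume *: "\<forall>x\<in>dom T. inner (the (T x)) y = inner x z"
    show "P y z" unfolding P_def ip_eq_iff
    proof safe
      fix x c w assume "T x = Some w"
      then have "x \<in> dom T" by auto
      then have "smul c x \<in> dom T" "the (T (smul c x)) = smul c (the (T x))"
        using True unfolding linear_operator_def by (auto simp: subspace_scale)
      then show "inner (smul c (the (T x))) y = inner (smul c x) z" using * by metis
    qed
  qed (metis P_def re_ip)
  have uniq: "z = z'" if "P y z" "P y z'" for y z z'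
  proof -
    have "z - z' = 0"
      using True that unfolding P_inner by (intro orthogonal_dense[of "dom T"]) (auto simp: inner_diff_right)
    then show ?thesis by simp
  qed
  have "adjoint_operator ip T y = Some z \<longleftrightarrow> P y z" for y z
    unfolding adjoint_operator_def P_def[symmetric] using uniq[of y] theI[of "P y"]
    by (auto intro!: the_equality)
  then have "adjoint_operator ip T = T \<longleftrightarrow> (\<forall>y z. T y = Some z \<longleftrightarrow> P y z)"
    by (metis (no_types, opaque_lifting) ext not_None_eq)
  then show ?thesis using True unfolding self_adjoint_def P_inner by simp
qed (auto simp: self_adjoint_def)

end

lemmas real_self_adjoint_iff = hilbert_space.self_adjoint_iff_inner[OF hilbert_space_real]

context hilbert_space
begin

lemma self_adjoint_iff_real:
  "self_adjoint smul ip T \<longleftrightarrow> linear_operator smul T \<and> self_adjoint scaleR inner T"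
  unfolding self_adjoint_iff_inner real_self_adjoint_iff
  by (auto intro: linear_operator_imp_real)

lemma self_adjoint_symmetric:
  assumes "self_adjoint smul ip T" "x \<in> dom T" "y \<in> dom T"
  shows "ip (the (T x)) y = ip x (the (T y))"
proof -
  have "smul c x \<in> dom T" "the (T (smul c x)) = smul c (the (T x))" for c
    using assms unfolding self_adjoint_def linear_operator_def by (auto simp: subspace_scale)
  moreover have "inner (the (T u)) y = inner u (the (T y))" if "u \<in> dom T" for u
  proof -
    have "T y = Some (the (T y))" using assms(3) by auto
    then show ?thesis using assms(1) that unfolding self_adjoint_iff_inner by blast
  qed
  ultimately show ?thesis unfolding ip_eq_iff by metis
qed

text \<open>
  Symmetry makes \<open>ip (T g) g\<close> equal to its conjugate, so it carries no more information than its
  real part.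
\<close>

lemma positive_iff_real:
  assumes "self_adjoint smul ip T"
  shows "positive_operator ip T \<longleftrightarrow> positive_operator inner T"
proof -
  have "ip (the (T g)) g \<in> \<real>\<^sub>\<ge>\<^sub>0 \<longleftrightarrow> inner (the (T g)) g \<in> \<real>\<^sub>\<ge>\<^sub>0" if "g \<in> dom T" for g
  proof -
    have "conjg (ip (the (T g)) g) = ip (the (T g)) g"
      by (metis assms ip_commute self_adjoint_symmetric that)
    then show ?thesis
      using nonneg_Reals_of_real_iff[of "inner (the (T g)) g", where 'a=real]
      by (simp add: nonneg_Reals_iff_re re_ip)
  qed
  then show ?thesis by (simp add: positive_operator_def)
qed

end

section \<open>Semi-inner products on a subspace\<close>

lemma double_sequence_tendsto_0:
  fixes f :: "nat \<Rightarrow> nat \<Rightarrow> real"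
  shows "((\<lambda>(n, m). f n m) \<longlongrightarrow> 0) (sequentially \<times>\<^sub>F sequentially) \<longleftrightarrow>
    (\<forall>e>0. \<exists>N. \<forall>n\<ge>N. \<forall>m\<ge>N. \<bar>f n m\<bar> < e)"
  unfolding tendsto_iff eventually_prod_sequentially by (auto; blast)

lemma Cauchy_if_inner_tendsto_0:
  fixes x :: "nat \<Rightarrow> 'h::real_inner"
  assumes "((\<lambda>(n, m). inner (x n - x m) (x n - x m)) \<longlongrightarrow> 0) (sequentially \<times>\<^sub>F sequentially)"
  shows "Cauchy x"
proof (rule CauchyI)
  fix e :: real assume "e > 0"
  then obtain N where N: "\<forall>n\<ge>N. \<forall>m\<ge>N. \<bar>inner (x n - x m) (x n - x m)\<bar> < e\<^sup>2"
    using assms unfolding double_sequence_tendsto_0 by (meson zero_less_power)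
  have "norm (x n - x m) < e" if "n \<ge> N" "m \<ge> N" for n m
    using N that \<open>e > 0\<close>
    by (metis abs_of_nonneg inner_ge_zero power2_norm_eq_inner power_less_imp_less_base less_imp_le)
  then show "\<exists>M. \<forall>m\<ge>M. \<forall>n\<ge>M. norm (x m - x n) < e" by blast
qed

lemma tendsto_if_power2_diff_le:
  fixes f g :: "nat \<Rightarrow> real"
  assumes "\<And>n. (f n - l)\<^sup>2 \<le> g n" and "g \<longlonglongrightarrow> 0"
  shows "f \<longlonglongrightarrow> l"
proof -
  have "(\<lambda>n. sqrt (g n)) \<longlonglongrightarrow> 0" using tendsto_real_sqrt[OF assms(2)] by simp
  moreover have "norm (f n - l) \<le> sqrt (g n)" for n
    using real_le_rsqrt[of "\<bar>f n - l\<bar>"] assms(1) by simp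
  ultimately have "(\<lambda>n. f n - l) \<longlonglongrightarrow> 0"
    by (rule_tac Lim_null_comparison[where g = "\<lambda>n. sqrt (g n)"]) (rule always_eventually, blast)
  then show ?thesis by (rule LIM_zero_cancel)
qed

lemma real_nonneg_Reals_iff: "x \<in> \<real>\<^sub>\<ge>\<^sub>0 \<longleftrightarrow> 0 \<le> x" for x :: real
  using nonneg_Reals_of_real_iff[of x, where 'a=real] by simp

text \<open>
  Several forms are used besides the given one: its sum with \<open>inner\<close>, and the forms
  \<open>inner (A x) y\<close> and \<open>inner (A x) (A y)\<close> on the whole space.
\<close>

locale real_form =
  fixes D :: "'h::{real_inner,complete_space} set" and s :: "'h \<Rightarrow> 'h \<Rightarrow> real"
  assumes form: "nonneg_symmetric_form scaleR D s"
begin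

lemma subspace: "subspace D"
  and add_left: "\<And>f g h. \<lbrakk>f \<in> D; g \<in> D; h \<in> D\<rbrakk> \<Longrightarrow> s (f + g) h = s f h + s g h"
  and scale_left: "\<And>c g h. \<lbrakk>g \<in> D; h \<in> D\<rbrakk> \<Longrightarrow> s (c *\<^sub>R g) h = c * s g h"
  and sym: "\<And>g h. \<lbrakk>g \<in> D; h \<in> D\<rbrakk> \<Longrightarrow> s g h = s h g"
  and nonneg: "\<And>g. g \<in> D \<Longrightarrow> 0 \<le> s g g"
  using form
  unfolding nonneg_symmetric_form_def conjg_real_def subspace_raw_def[symmetric] real_nonneg_Reals_iff
  by auto

lemmas closed_ops = subspace_add[OF subspace] subspace_scale[OF subspace] subspace_diff[OF subspace]

lemma add_right: "\<lbrakk>f \<in> D; g \<in> D; h \<in> D\<rbrakk> \<Longrightarrow> s f (g + h) = s f g + s f h"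
  by (simp add: sym[of f] add_left closed_ops(1))

lemma scale_right: "\<lbrakk>g \<in> D; h \<in> D\<rbrakk> \<Longrightarrow> s g (c *\<^sub>R h) = c * s g h"
  by (simp add: sym[of g] scale_left closed_ops(2))

lemma diff_left: "\<lbrakk>f \<in> D; g \<in> D; h \<in> D\<rbrakk> \<Longrightarrow> s (f - g) h = s f h - s g h"
  using add_left[of "f - g" g h] by (simp add: closed_ops(3))

lemma diff_right: "\<lbrakk>f \<in> D; g \<in> D; h \<in> D\<rbrakk> \<Longrightarrow> s f (g - h) = s f g - s f h"
  by (simp add: sym[of f] diff_left closed_ops(3))

lemmas expand = add_left add_right scale_left scale_right diff_left diff_right closed_ops

lemma cauchy_schwarz:
  assumes "g \<in> D" "h \<in> D"
  shows "(s g h)\<^sup>2 \<le> s g g * s h h"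
proof -
  have "0 \<le> r\<^sup>2 * s g g - 2 * r * s g h + s h h" for r
  proof -
    have "0 \<le> s (r *\<^sub>R g - h) (r *\<^sub>R g - h)" using assms by (intro nonneg closed_ops)
    also have "\<dots> = r\<^sup>2 * s g g - 2 * r * s g h + s h h"
      using assms by (simp add: expand sym[of h g] power2_eq_square algebra_simps)
    finally show ?thesis .
  qed
  note pos = this
  show ?thesis
  proof (cases "s g g = 0")
    case True
    have "s g h = 0"
    proof (rule ccontr)
      assume "s g h \<noteq> 0"
      then show False using pos[of "(s h h + 1) / (2 * s g h)"] True by (simp add: field_simps)
    qed
    then show ?thesis using True by simp
  next
    case False
    then have "s g g > 0" using nonneg[OF assms(1)] by simp
    then show ?thesis using pos[of "s g h / s g g"] by (simp add: field_simps power2_eq_square)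
  qed
qed

lemma form_tendsto:
  assumes "\<And>n. g n \<in> D" "b \<in> D" "h \<in> D" "(\<lambda>n. s (g n - b) (g n - b)) \<longlonglongrightarrow> 0"
  shows "(\<lambda>n. s (g n) h) \<longlonglongrightarrow> s b h"
proof (rule tendsto_if_power2_diff_le)
  show "(s (g n) h - s b h)\<^sup>2 \<le> s (g n - b) (g n - b) * s h h" for n
    using cauchy_schwarz[of "g n - b" h] assms by (simp add: expand)
  show "(\<lambda>n. s (g n - b) (g n - b) * s h h) \<longlonglongrightarrow> 0"
    by (rule tendsto_mult_left_zero) (rule assms)
qed

text \<open>
  The Riesz representation theorem without completeness. A functional \<open>\<phi>\<close> that is bounded for \<open>s\<close> is
  represented by a minimising sequence of \<open>s h h - 2 * \<phi> h\<close>: the parallelogram law makes this sequence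
  Cauchy for \<open>s\<close>, and near-minimality forces the first variation to vanish in the limit. Where the
  sequence converges is decided in each application by what is complete there.
\<close>

lemma riesz_sequence:
  assumes add: "\<And>g h. g \<in> D \<Longrightarrow> h \<in> D \<Longrightarrow> \<phi> (g + h) = \<phi> g + \<phi> h"
    and scale: "\<And>c h. h \<in> D \<Longrightarrow> \<phi> (c *\<^sub>R h) = c * \<phi> h"
    and bound: "\<And>h. h \<in> D \<Longrightarrow> (\<phi> h)\<^sup>2 \<le> C * s h h"
    and "0 \<le> C"
  obtains v where "\<And>n. v n \<in> D"
    and "((\<lambda>(n, m). s (v n - v m) (v n - v m)) \<longlongrightarrow> 0) (sequentially \<times>\<^sub>F sequentially)"
    and "\<And>w. w \<in> D \<Longrightarrow> (\<lambda>n. s (v n) w) \<longlonglongrightarrow> \<phi> w"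
proof -
  define F where "F h = s h h - 2 * \<phi> h" for h
  have F_lower: "- C \<le> F h" if "h \<in> D" for h
  proof -
    have "(2 * \<phi> h)\<^sup>2 \<le> 4 * (C * s h h)" using bound[OF that] by (simp add: power_mult_distrib)
    also have "\<dots> \<le> (C + s h h)\<^sup>2"
      using zero_le_power2[of "C - s h h"] by (simp add: power2_eq_square algebra_simps)
    finally have "(2 * \<phi> h)\<^sup>2 \<le> (C + s h h)\<^sup>2" .
    then have "2 * \<phi> h \<le> C + s h h"
      using nonneg[OF that] \<open>0 \<le> C\<close> by (rule_tac power2_le_imp_le) simp_all
    then show ?thesis by (simp add: F_def)
  qed
  define m where "m = Inf (F ` D)"
  have ne: "F ` D \<noteq> {}" using subspace_0[OF subspace] by auto
  have bdd: "bdd_below (F ` D)" using F_lower by (auto intro!: bdd_belowI)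
  have m_le: "m \<le> F h" if "h \<in> D" for h
    unfolding m_def using bdd that by (intro cInf_lower) auto
  have "\<exists>h\<in>D. F h < m + inverse (real (Suc n))" for n
    using cInf_lessD[OF ne, of "m + inverse (real (Suc n))"] by (auto simp: m_def)
  then obtain v where v: "\<And>n. v n \<in> D" "\<And>n. F (v n) < m + inverse (real (Suc n))" by metis
  have gap: "s (v n - v k) (v n - v k) \<le> 2 * inverse (real (Suc n)) + 2 * inverse (real (Suc k))" for n k
  proof -
    let ?mid = "(1/2) *\<^sub>R (v n + v k)"
    have "?mid \<in> D" by (intro closed_ops v)
    then have "m \<le> F ?mid" by (rule m_le)
    moreover have "s (v n - v k) (v n - v k) = 2 * F (v n) + 2 * F (v k) - 4 * F ?mid"
      unfolding F_def using v by (simp add: expand add scale sym[of "v k" "v n"] algebra_simps)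
    ultimately show ?thesis using v(2)[of n] v(2)[of k] by linarith
  qed
  have weak: "(\<lambda>n. s (v n) w) \<longlonglongrightarrow> \<phi> w" if w: "w \<in> D" for w
  proof -
    \<comment> \<open>Adding \<open>1\<close> avoids a division by zero when \<open>w\<close> is degenerate for \<open>s\<close>.\<close>
    define K where "K = s w w + 1"
    have K: "K > 0" "s w w \<le> K" using nonneg[OF w] by (auto simp: K_def)
    have "(s (v n) w - \<phi> w)\<^sup>2 \<le> K * inverse (real (Suc n))" for n
    proof -
      define d where "d = s (v n) w - \<phi> w"
      \<comment> \<open>The step that minimises the quadratic upper bound \<open>2 * r * d + r\<^sup>2 * K\<close>.\<close>
      let ?r = "- d / K"
      have "F (v n + r *\<^sub>R w) = F (v n) + 2 * r * d + r\<^sup>2 * s w w" for r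
        unfolding F_def d_def using v w
        by (simp add: expand add scale sym[of w "v n"] power2_eq_square algebra_simps)
      moreover have "m \<le> F (v n + ?r *\<^sub>R w)" by (intro m_le closed_ops v w)
      ultimately have "m - F (v n) \<le> 2 * ?r * d + ?r\<^sup>2 * s w w" by (simp only: diff_le_eq ac_simps)
      also have "\<dots> \<le> 2 * ?r * d + ?r\<^sup>2 * K" using K by (intro add_left_mono mult_left_mono) auto
      also have "\<dots> = - (d\<^sup>2 / K)" using K by (simp add: power2_eq_square field_simps)
      finally have "d\<^sup>2 / K \<le> inverse (real (Suc n))" using v(2)[of n] by linarith
      then show ?thesis using K by (simp add: d_def field_simps)
    qed
    moreover have "(\<lambda>n. K * inverse (real (Suc n))) \<longlonglongrightarrow> 0"
      by (rule tendsto_mult_right_zero) (rule LIMSEQ_inverse_real_of_nat)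
    ultimately show ?thesis by (rule tendsto_if_power2_diff_le)
  qed
  have "((\<lambda>(n, m). s (v n - v m) (v n - v m)) \<longlongrightarrow> 0) (sequentially \<times>\<^sub>F sequentially)"
    unfolding double_sequence_tendsto_0
  proof safe
    fix e :: real assume "e > 0"
    then obtain N where N: "inverse (real (Suc N)) < e / 4" using reals_Archimedean[of "e / 4"] by auto
    have "\<bar>s (v n - v k) (v n - v k)\<bar> < e" if "n \<ge> N" "k \<ge> N" for n k
    proof -
      have "inverse (real (Suc n)) \<le> inverse (real (Suc N))" "inverse (real (Suc k)) \<le> inverse (real (Suc N))"
        using that by auto
      moreover have "0 \<le> s (v n - v k) (v n - v k)" by (intro nonneg closed_ops v)
      ultimately show ?thesis using gap[of n k] N by linarith
    qed
    then show "\<exists>N. \<forall>n\<ge>N. \<forall>m\<ge>N. \<bar>s (v n - v m) (v n - v m)\<bar> < e" by blast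
  qed
  with v(1) weak that show ?thesis by blast
qed

end

lemma real_formI:
  assumes "subspace D"
    and "\<And>f g h. \<lbrakk>f \<in> D; g \<in> D; h \<in> D\<rbrakk> \<Longrightarrow> s (f + g) h = s f h + s g h"
    and "\<And>c g h. \<lbrakk>g \<in> D; h \<in> D\<rbrakk> \<Longrightarrow> s (c *\<^sub>R g) h = c * s g h"
    and "\<And>g h. \<lbrakk>g \<in> D; h \<in> D\<rbrakk> \<Longrightarrow> s g h = s h g"
    and "\<And>g. g \<in> D \<Longrightarrow> 0 \<le> s g g"
  shows "real_form D s"
  unfolding real_form_def nonneg_symmetric_form_def conjg_real_def
    subspace_raw_def[symmetric] real_nonneg_Reals_iff
  using assms by blast

lemma real_form_pullback:
  fixes A :: "'h::{real_inner,complete_space} \<Rightarrow> 'h"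
  assumes "linear A"
  shows "real_form UNIV (\<lambda>x y. inner (A x) (A y))"
  using assms by (intro real_formI)
    (simp_all add: linear_add linear_scale inner_add_left, metis inner_commute)

text \<open>
  The form \<open>inner (A x) (A y)\<close> is in general not complete, but the images under \<open>A\<close> of a Cauchy
  sequence converge in the ambient space.
\<close>

lemma riesz_through_map:
  fixes A :: "'h::{real_inner,complete_space} \<Rightarrow> 'h"
  assumes A: "linear A" and \<phi>: "linear \<phi>"
    and bound: "\<And>v. (\<phi> v)\<^sup>2 \<le> C * (norm (A v))\<^sup>2" and "0 \<le> C"
  obtains u where "u \<in> closure (range A)" and "\<And>w. inner u (A w) = \<phi> w"
proof -
  interpret real_form UNIV "\<lambda>x y. inner (A x) (A y)" by (rule real_form_pullback[OF A])
  obtain v where cauchy: "((\<lambda>(n, m). inner (A (v n - v m)) (A (v n - v m))) \<longlongrightarrow> 0) (sequentially \<times>\<^sub>F sequentially)"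
    and lim: "\<And>w. (\<lambda>n. inner (A (v n)) (A w)) \<longlonglongrightarrow> \<phi> w"
    using riesz_sequence[of \<phi> C] \<phi> bound \<open>0 \<le> C\<close>
    by (auto simp: linear_add linear_scale power2_norm_eq_inner)
  have "Cauchy (\<lambda>n. A (v n))"
    using cauchy by (intro Cauchy_if_inner_tendsto_0) (simp add: linear_diff[OF A])
  then obtain u where u: "(\<lambda>n. A (v n)) \<longlonglongrightarrow> u" using Cauchy_convergent convergent_def by blast
  have "inner u (A w) = \<phi> w" for w
    by (rule LIMSEQ_unique[OF tendsto_inner[OF u tendsto_const] lim])
  moreover have "u \<in> closure (range A)"
    unfolding closure_sequential by (rule exI[of _ "\<lambda>n. A (v n)"]) (simp add: u)
  ultimately show ?thesis using that by blast
qed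

text \<open>
  The functional \<open>inner v (A w)\<close> is represented by some \<open>u\<close> in the closure of the range; symmetry turns
  this into \<open>A u = A v\<close>, and injectivity into \<open>u = v\<close>.
\<close>

lemma dense_range_symmetric:
  fixes A :: "'h::{real_inner,complete_space} \<Rightarrow> 'h"
  assumes A: "linear A" "inj A" and sym: "\<And>x y. inner (A x) y = inner x (A y)"
  shows "closure (range A) = UNIV"
proof -
  have "v \<in> closure (range A)" for v
  proof -
    have "(inner v (A w))\<^sup>2 \<le> (norm v)\<^sup>2 * (norm (A w))\<^sup>2" for w
      by (metis Cauchy_Schwarz_ineq power2_norm_eq_inner)
    moreover have "linear (\<lambda>w. inner v (A w))"
      using A by (intro linearI) (auto simp: linear_add linear_scale inner_add_right)
    ultimately obtain u where u: "u \<in> closure (range A)" "\<And>w. inner u (A w) = inner v (A w)"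
      using riesz_through_map[OF A(1), of "\<lambda>w. inner v (A w)" "(norm v)\<^sup>2"] by auto
    then have "inner (A u) w = inner (A v) w" for w by (metis sym)
    then have "A u = A v" by (metis vector_eq_rdot)
    then show ?thesis using u A(2) by (metis injD)
  qed
  then show ?thesis by blast
qed

text \<open>
  A special case of Douglas' range inclusion theorem. The vector \<open>u\<close> that represents \<open>inner v g\<close> through
  \<open>A\<close> is the preimage of \<open>g\<close>.
\<close>

lemma range_if_bounded:
  fixes A :: "'h::{real_inner,complete_space} \<Rightarrow> 'h"
  assumes A: "linear A" and sym: "\<And>x y. inner (A x) y = inner x (A y)"
    and bound: "\<And>v. (inner v g)\<^sup>2 \<le> C * (norm (A v))\<^sup>2" and "0 \<le> C"
  shows "g \<in> range A"
proof -
  have "linear (\<lambda>v. inner v g)" by (intro linearI) (auto simp: inner_add_left)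
  then obtain u where "\<And>w. inner u (A w) = inner w g"
    using riesz_through_map[OF A _ bound \<open>0 \<le> C\<close>] by blast
  then have "inner w (A u) = inner w g" for w by (metis sym inner_commute)
  then have "A u = g" by (metis vector_eq_ldot)
  then show ?thesis by blast
qed

section \<open>Positive contractions and their square roots\<close>

definition positive_contraction :: "('h::{real_inner,complete_space} \<Rightarrow> 'h) \<Rightarrow> bool" where
  "positive_contraction A \<longleftrightarrow> linear A \<and> (\<forall>x y. inner (A x) y = inner x (A y)) \<and>
     (\<forall>x. 0 \<le> inner (A x) x \<and> inner (A x) x \<le> inner x x)"

lemma positive_contractionD:
  assumes "positive_contraction A"
  shows "linear A" and "inner (A x) y = inner x (A y)"
    and "0 \<le> inner (A x) x" and "inner (A x) x \<le> inner x x"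
  using assms by (auto simp only: positive_contraction_def)

lemma positive_contractionI:
  assumes "linear A" and "\<And>x y. inner (A x) y = inner x (A y)"
    and "\<And>x. 0 \<le> inner (A x) x" and "\<And>x. norm (A x) \<le> norm x"
  shows "positive_contraction A"
proof -
  have "inner (A x) x \<le> inner x x" for x
  proof -
    have "inner (A x) x \<le> norm (A x) * norm x" by (rule norm_cauchy_schwarz)
    also have "\<dots> \<le> norm x * norm x" by (intro mult_right_mono assms(4)) simp
    finally show ?thesis by (simp only: dot_square_norm power2_eq_square)
  qed
  then show ?thesis unfolding positive_contraction_def using assms(1-3) by blast
qed

lemma real_form_positive_contraction:
  "positive_contraction A \<Longrightarrow> real_form UNIV (\<lambda>x y. inner (A x) y)"
  by (rule real_formI)
    (simp_all add: linear_add linear_scale inner_add_left positive_contractionD(1,3),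
      metis positive_contractionD(2) inner_commute)

text \<open>
  The Cauchy-Schwarz inequality for the form \<open>inner (A x) y\<close>, applied to \<open>x\<close> and \<open>A x\<close>.
\<close>

lemma positive_contraction_image_bound:
  assumes "positive_contraction A"
  shows "(norm (A x))\<^sup>2 \<le> inner (A x) x"
proof -
  interpret real_form UNIV "\<lambda>x y. inner (A x) y" by (rule real_form_positive_contraction[OF assms])
  have "((norm (A x))\<^sup>2)\<^sup>2 \<le> inner (A x) x * inner (A (A x)) (A x)"
    using cauchy_schwarz[of x "A x"] by (simp add: power2_norm_eq_inner)
  also have "\<dots> \<le> inner (A x) x * (norm (A x))\<^sup>2"
    unfolding power2_norm_eq_inner by (intro mult_left_mono positive_contractionD[OF assms])
  finally have "(norm (A x))\<^sup>2 * (norm (A x))\<^sup>2 \<le> inner (A x) x * (norm (A x))\<^sup>2"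
    by (simp add: power2_eq_square)
  note le = this
  show ?thesis
  proof (cases "A x = 0")
    case False
    then show ?thesis by (rule_tac mult_right_le_imp_le[OF le]) simp
  qed simp
qed

lemma norm_positive_contraction_le:
  assumes "positive_contraction A"
  shows "norm (A x) \<le> norm x"
proof (rule power2_le_imp_le)
  show "(norm (A x))\<^sup>2 \<le> (norm x)\<^sup>2"
    using positive_contraction_image_bound[OF assms, of x] positive_contractionD(4)[OF assms, of x]
    unfolding power2_norm_eq_inner by linarith
qed simp

lemma bounded_linear_positive_contraction: "positive_contraction A \<Longrightarrow> bounded_linear A"
  using norm_positive_contraction_le[of A]
  by (intro bounded_linear_intro[where K=1])
    (simp_all add: positive_contractionD(1) linear_add linear_scale)

lemma positive_contraction_complement:
  "positive_contraction A \<Longrightarrow> positive_contraction (\<lambda>x. x - A x)"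
  unfolding positive_contraction_def
  by (auto simp: linear_compose_sub linear_id[unfolded id_def] inner_diff)

text \<open>
  If \<open>R\<close> is the root of \<open>A\<close>, then \<open>L = 1 - R\<close> solves \<open>L = (1 - A + L\<^sup>2) / 2\<close>; this is the iteration
  of that equation. It involves only \<open>A\<close>, so the root inherits every commutation property of \<open>A\<close>.
\<close>

fun sqrt_iterate :: "('h::real_vector \<Rightarrow> 'h) \<Rightarrow> nat \<Rightarrow> 'h \<Rightarrow> 'h" where
  "sqrt_iterate A 0 x = 0"
| "sqrt_iterate A (Suc n) x = (1/2) *\<^sub>R (x - A x + sqrt_iterate A n (sqrt_iterate A n x))"

text \<open>
  The same iteration for the scalar \<open>A = 0\<close>. It increases to \<open>1\<close> and dominates the operator iteration
  and its increments in norm.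
\<close>

fun sqrt_majorant :: "nat \<Rightarrow> real" where
  "sqrt_majorant 0 = 0"
| "sqrt_majorant (Suc n) = (1 + (sqrt_majorant n)\<^sup>2) / 2"

definition contraction_sqrt :: "('h::real_normed_vector \<Rightarrow> 'h) \<Rightarrow> 'h \<Rightarrow> 'h" where
  "contraction_sqrt A x = x - lim (\<lambda>n. sqrt_iterate A n x)"

lemma sqrt_majorant_bounds: "0 \<le> sqrt_majorant n \<and> sqrt_majorant n \<le> 1"
  by (induction n) (auto simp: power_le_one)

lemma sqrt_majorant_mono: "sqrt_majorant n \<le> sqrt_majorant (Suc n)"
  using zero_le_power2[of "1 - sqrt_majorant n"] by (simp add: power2_eq_square field_simps)

lemma Cauchy_sqrt_majorant: "Cauchy sqrt_majorant"
proof -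
  have "incseq sqrt_majorant" by (rule incseq_SucI) (rule sqrt_majorant_mono)
  then have "convergent sqrt_majorant"
    using sqrt_majorant_bounds by (metis incseq_convergent convergentI)
  then show ?thesis by (rule convergent_Cauchy)
qed

context
  fixes A :: "'h::{real_inner,complete_space} \<Rightarrow> 'h"
  assumes A: "positive_contraction A"
begin

private abbreviation "Y \<equiv> sqrt_iterate A"

lemma sqrt_iterate_linear: "linear (Y n)"
proof (induction n)
  case 0 then show ?case by (simp add: linear_zero)
next
  case (Suc n)
  have "linear A" using A by (simp add: positive_contraction_def)
  then show ?case using Suc by (intro linearI) (simp_all add: linear_add linear_scale algebra_simps)
qed

lemma sqrt_iterate_symmetric: "inner (Y n x) y = inner x (Y n y)"
proof (induction n arbitrary: x y)
  case (Suc n)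
  have "inner (A x) y = inner x (A y)" using A by (simp add: positive_contraction_def)
  then show ?case by (simp add: inner_add inner_diff Suc)
qed simp

lemma sqrt_iterate_nonneg: "0 \<le> inner (Y n x) x"
proof (cases n)
  case (Suc m)
  have "0 \<le> inner (x - A x) x"
    by (rule positive_contractionD(3)[OF positive_contraction_complement[OF A]])
  moreover have "0 \<le> inner (Y m (Y m x)) x"
    using inner_ge_zero[of "Y m x"] by (simp only: sqrt_iterate_symmetric)
  ultimately show ?thesis
    unfolding Suc sqrt_iterate.simps inner_scaleR_left inner_add_left[of "x - A x"] by simp
qed simp

lemma norm_sqrt_iterate_le: "norm (Y n x) \<le> sqrt_majorant n * norm x"
proof (induction n arbitrary: x)
  case (Suc n)
  have "norm (Y n (Y n x)) \<le> sqrt_majorant n * (sqrt_majorant n * norm x)"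
    using Suc[of "Y n x"] Suc[of x] sqrt_majorant_bounds[of n] by (meson mult_left_mono order_trans)
  moreover have "norm (x - A x) \<le> norm x"
    using norm_positive_contraction_le[OF positive_contraction_complement[OF A]] .
  ultimately have "norm (x - A x + Y n (Y n x)) \<le> norm x + sqrt_majorant n * (sqrt_majorant n * norm x)"
    by (meson add_mono norm_triangle_ineq order_trans)
  then show ?case
    unfolding sqrt_iterate.simps norm_scaleR by (simp add: power2_eq_square algebra_simps)
qed simp

lemma sqrt_iterate_commute:
  assumes "linear Z" "\<And>x. Z (A x) = A (Z x)"
  shows "Z (Y n x) = Y n (Z x)"
  using assms by (induction n arbitrary: x) (simp_all add: linear_add linear_diff linear_scale linear_0)

lemma sqrt_iterate_commute_iterates: "Y m (Y n x) = Y n (Y m x)"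
proof -
  have "linear A" using A by (simp add: positive_contraction_def)
  then have "A (Y m x) = Y m (A x)" for x by (rule sqrt_iterate_commute) simp
  then show ?thesis by (intro sqrt_iterate_commute sqrt_iterate_linear) simp
qed

text \<open>
  The iterates commute, so the increment factors as
  \<open>Y\<^sub>n\<^sub>+\<^sub>2 - Y\<^sub>n\<^sub>+\<^sub>1 = (Y\<^sub>n\<^sub>+\<^sub>1 + Y\<^sub>n) (Y\<^sub>n\<^sub>+\<^sub>1 - Y\<^sub>n) / 2\<close>, exactly as for the scalar majorant.
\<close>

lemma norm_sqrt_iterate_step:
  "norm (Y (Suc n) x - Y n x) \<le> (sqrt_majorant (Suc n) - sqrt_majorant n) * norm x"
proof (induction n arbitrary: x)
  case 0 then show ?case using norm_sqrt_iterate_le[of 1 x] by simp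
next
  case (Suc n)
  let ?d = "\<lambda>x. Y (Suc n) x - Y n x"
  let ?a = "sqrt_majorant (Suc n)" and ?b = "sqrt_majorant n"
  have ba: "?b \<le> ?a" by (rule sqrt_majorant_mono)
  have "Y (Suc (Suc n)) x - Y (Suc n) x = (1/2) *\<^sub>R (Y (Suc n) (Y (Suc n) x) - Y n (Y n x))"
    unfolding sqrt_iterate.simps(2)[of A "Suc n"] sqrt_iterate.simps(2)[of A n x]
    by (simp add: algebra_simps del: sqrt_iterate.simps)
  also have "Y (Suc n) (Y (Suc n) x) - Y n (Y n x) = Y (Suc n) (?d x) + Y n (?d x)"
    using sqrt_iterate_commute_iterates[of n "Suc n" x]
    by (simp add: linear_diff[OF sqrt_iterate_linear] del: sqrt_iterate.simps)
  finally have "norm (Y (Suc (Suc n)) x - Y (Suc n) x) = norm (Y (Suc n) (?d x) + Y n (?d x)) / 2"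
    by simp
  also have "\<dots> \<le> (norm (Y (Suc n) (?d x)) + norm (Y n (?d x))) / 2"
    by (intro divide_right_mono norm_triangle_ineq) simp
  also have "\<dots> \<le> (?a * norm (?d x) + ?b * norm (?d x)) / 2"
    by (intro divide_right_mono add_mono norm_sqrt_iterate_le) simp
  also have "\<dots> = (?a + ?b) / 2 * norm (?d x)" by (simp add: algebra_simps)
  also have "\<dots> \<le> (?a + ?b) / 2 * ((?a - ?b) * norm x)"
    using sqrt_majorant_bounds[of n] sqrt_majorant_bounds[of "Suc n"]
    by (intro mult_left_mono Suc) (auto simp del: sqrt_majorant.simps)
  also have "\<dots> = (sqrt_majorant (Suc (Suc n)) - ?a) * norm x"
  proof -
    have b: "?b\<^sup>2 = 2 * ?a - 1" by (simp add: field_simps)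
    have "(?a\<^sup>2 - ?b\<^sup>2) / 2 = (1 + ?a\<^sup>2) / 2 - ?a"
      unfolding b by (simp add: diff_divide_distrib add_divide_distrib del: sqrt_majorant.simps)
    moreover have "(?a + ?b) / 2 * ((?a - ?b) * norm x) = (?a\<^sup>2 - ?b\<^sup>2) / 2 * norm x"
      by (simp add: power2_eq_square field_simps del: sqrt_majorant.simps)
    ultimately show ?thesis
      by (simp only: sqrt_majorant.simps(2)[of "Suc n"])
  qed
  finally show ?case .
qed

lemma sqrt_iterate_converges: "(\<lambda>n. Y n x) \<longlonglongrightarrow> x - contraction_sqrt A x"
proof -
  have dist: "norm (Y (n + k) x - Y n x) \<le> (sqrt_majorant (n + k) - sqrt_majorant n) * norm x" for n k
  proof (induction k)
    case (Suc k)
    have "norm (Y (n + Suc k) x - Y n x) \<le> norm (Y (Suc (n + k)) x - Y (n + k) x) + norm (Y (n + k) x - Y n x)"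
      by (metis add_Suc_right norm_diff_triangle_ineq norm_triangle_sub diff_add_cancel add_diff_eq norm_triangle_ineq)
    also have "\<dots> \<le> (sqrt_majorant (n + Suc k) - sqrt_majorant n) * norm x"
      using norm_sqrt_iterate_step[of "n + k" x] Suc
      by (simp add: algebra_simps del: sqrt_majorant.simps sqrt_iterate.simps)
    finally show ?case .
  qed simp
  have "Cauchy (\<lambda>n. Y n x)"
  proof (rule CauchyI')
    fix e :: real assume "e > 0"
    then have "e / (norm x + 1) > 0" by (simp add: add_nonneg_pos)
    then obtain N where N: "\<forall>m\<ge>N. \<forall>n\<ge>N. norm (sqrt_majorant m - sqrt_majorant n) < e / (norm x + 1)"
      using CauchyD[OF Cauchy_sqrt_majorant] by metis
    have "dist (Y m x) (Y n x) < e" if "m \<ge> N" "n > m" for m n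
    proof -
      have "norm (Y n x - Y m x) \<le> (sqrt_majorant n - sqrt_majorant m) * norm x"
        using dist[of m "n - m"] that by simp
      also have "\<dots> \<le> e / (norm x + 1) * norm x"
      proof (rule mult_right_mono)
        have "norm (sqrt_majorant n - sqrt_majorant m) < e / (norm x + 1)" using N that by simp
        then show "sqrt_majorant n - sqrt_majorant m \<le> e / (norm x + 1)"
          unfolding real_norm_def by linarith
      qed simp
      also have "\<dots> < e"
        using \<open>e > 0\<close> add_nonneg_pos[OF norm_ge_zero[of x] zero_less_one] by (simp add: field_simps)
      finally show ?thesis by (simp add: dist_norm norm_minus_commute)
    qed
    then show "\<exists>M. \<forall>m\<ge>M. \<forall>n>m. dist (Y m x) (Y n x) < e" by blast
  qed
  then show ?thesis unfolding contraction_sqrt_def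
    by (simp add: Cauchy_convergent flip: convergent_LIMSEQ_iff)
qed

text \<open>
  Commutation is stated through an invariant closed subspace of pairs: applied to the graph of a
  bounded operator it says that whatever commutes with \<open>A\<close> commutes with its root.
\<close>

lemma contraction_sqrt_invariant:
  assumes G: "closed G" "subspace G" and inv: "\<And>x y. (x, y) \<in> G \<Longrightarrow> (A x, A y) \<in> G"
    and "(x, y) \<in> G"
  shows "(contraction_sqrt A x, contraction_sqrt A y) \<in> G"
proof -
  have "(Y n x, Y n y) \<in> G" if "(x, y) \<in> G" for n x y
    using that
  proof (induction n arbitrary: x y)
    case 0 then show ?case using subspace_0[OF G(2)] by (simp add: zero_prod_def)
  next
    case (Suc n)
    have "(1/2) *\<^sub>R ((x, y) - (A x, A y) + (Y n (Y n x), Y n (Y n y))) \<in> G"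
      by (intro subspace_scale[OF G(2)] subspace_add[OF G(2)] subspace_diff[OF G(2)] Suc inv)
    then show ?case by simp
  qed
  then have "(x - contraction_sqrt A x, y - contraction_sqrt A y) \<in> G"
    using assms(4) by (intro closed_sequentially[OF G(1) _ tendsto_Pair[OF sqrt_iterate_converges sqrt_iterate_converges]]) auto
  then show ?thesis
    using subspace_diff[OF G(2) assms(4)] by fastforce
qed

lemma contraction_sqrt_commute:
  assumes Z: "bounded_linear Z" "\<And>x. Z (A x) = A (Z x)"
  shows "Z (contraction_sqrt A x) = contraction_sqrt A (Z x)"
proof -
  interpret Z: bounded_linear Z by fact
  let ?G = "{p. snd p = Z (fst p)}"
  have "closed ?G" by (intro closed_Collect_eq continuous_intros Z.continuous_on)
  moreover have "subspace ?G" by (auto simp: subspace_def Z.zero Z.add Z.scaleR)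
  ultimately show ?thesis using contraction_sqrt_invariant[of ?G x "Z x"] Z(2) by simp
qed

lemma positive_contraction_sqrt: "positive_contraction (contraction_sqrt A)"
proof -
  let ?L = "\<lambda>x. x - contraction_sqrt A x"
  note lim = sqrt_iterate_converges
  have "?L (x + y) = ?L x + ?L y" for x y
    by (rule LIMSEQ_unique[OF lim])
      (use tendsto_add[OF lim[of x] lim[of y]] in \<open>simp add: linear_add[OF sqrt_iterate_linear]\<close>)
  moreover have "?L (c *\<^sub>R x) = c *\<^sub>R ?L x" for c x
    by (rule LIMSEQ_unique[OF lim])
      (use tendsto_scaleR[OF tendsto_const lim[of x], of c] in \<open>simp add: linear_scale[OF sqrt_iterate_linear]\<close>)
  ultimately have lin: "linear ?L" by (rule linearI)
  have sym: "inner (?L x) y = inner x (?L y)" for x y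
    by (rule LIMSEQ_unique[OF tendsto_inner[OF lim tendsto_const]])
      (use tendsto_inner[OF tendsto_const lim[of y], of x] in \<open>simp add: sqrt_iterate_symmetric\<close>)
  have pos: "0 \<le> inner (?L x) x" for x
    by (rule LIMSEQ_le_const[OF tendsto_inner[OF lim tendsto_const]]) (auto simp: sqrt_iterate_nonneg)
  have "norm (?L x) \<le> norm x" for x
  proof (rule LIMSEQ_le_const2[OF tendsto_norm[OF lim]])
    have "norm (Y n x) \<le> 1 * norm x" for n
      using norm_sqrt_iterate_le[of n x] sqrt_majorant_bounds[of n]
      by (meson mult_right_mono norm_ge_zero order_trans)
    then show "\<exists>N. \<forall>n\<ge>N. norm (Y n x) \<le> norm x" by auto
  qed
  with lin sym pos have "positive_contraction ?L" by (intro positive_contractionI)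
  then show ?thesis using positive_contraction_complement by fastforce
qed

lemma contraction_sqrt_square: "contraction_sqrt A (contraction_sqrt A x) = A x"
proof -
  define L where "L x = x - contraction_sqrt A x" for x
  have lim: "(\<lambda>n. Y n x) \<longlonglongrightarrow> L x" for x unfolding L_def by (rule sqrt_iterate_converges)
  have "(\<lambda>n. Y n (Y n x)) \<longlonglongrightarrow> L (L x)"
  proof -
    have "norm (Y n (Y n x) - L (L x)) \<le> norm (Y n x - L x) + norm (Y n (L x) - L (L x))" for n
    proof -
      have "norm (Y n (Y n x - L x)) \<le> 1 * norm (Y n x - L x)"
        using norm_sqrt_iterate_le[of n "Y n x - L x"] sqrt_majorant_bounds[of n]
        by (meson mult_right_mono norm_ge_zero order_trans)
      moreover have "Y n (Y n x) - L (L x) = Y n (Y n x - L x) + (Y n (L x) - L (L x))"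
        by (simp add: linear_diff[OF sqrt_iterate_linear])
      ultimately show ?thesis by (metis norm_triangle_le add_right_mono mult_1)
    qed
    moreover have "(\<lambda>n. norm (Y n x - L x) + norm (Y n (L x) - L (L x))) \<longlonglongrightarrow> norm (L x - L x) + norm (L (L x) - L (L x))"
      by (intro tendsto_intros lim)
    ultimately have "(\<lambda>n. Y n (Y n x) - L (L x)) \<longlonglongrightarrow> 0"
      by (rule_tac Lim_null_comparison[where g="\<lambda>n. norm (Y n x - L x) + norm (Y n (L x) - L (L x))"])
        (rule always_eventually, blast, simp only: diff_self norm_zero add_0)
    then show ?thesis by (simp add: LIM_zero_iff)
  qed
  then have "(\<lambda>n. Y (Suc n) x) \<longlonglongrightarrow> (1/2) *\<^sub>R (x - A x + L (L x))"
    unfolding sqrt_iterate.simps by (intro tendsto_intros)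
  then have "L x = (1/2) *\<^sub>R (x - A x + L (L x))"
    by (rule LIMSEQ_unique[OF LIMSEQ_Suc[OF lim]])
  then have "2 *\<^sub>R L x = x - A x + L (L x)"
    by (metis scaleR_half_double scaleR_2 scaleR_right_distrib)
  then show ?thesis
    by (simp add: L_def scaleR_2 algebra_simps
        linear_diff[OF positive_contractionD(1)[OF positive_contraction_sqrt]])
qed

text \<open>
  With \<open>K\<close> the root of \<open>A\<close>, the product is \<open>K C K\<close>.
\<close>

lemma positive_commuting_product:
  assumes "positive_contraction C" "\<And>x. A (C x) = C (A x)"
  shows "0 \<le> inner (A (C x)) x"
proof -
  let ?K = "contraction_sqrt A"
  have "C (?K x) = ?K (C x)" for x
    using assms by (intro contraction_sqrt_commute bounded_linear_positive_contraction) auto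
  then have "inner (A (C x)) x = inner (C (?K x)) (?K x)"
    using positive_contraction_sqrt by (metis contraction_sqrt_square positive_contraction_def)
  then show ?thesis using positive_contractionD(3)[OF assms(1)] by metis
qed

text \<open>
  For \<open>d = A x - C x\<close> the hypotheses give \<open>(A + C) d = 0\<close>. Both forms are nonnegative, so \<open>A d = 0\<close> and
  \<open>C d = 0\<close>, and then the squared norm of \<open>d\<close> is \<open>inner x (A d - C d) = 0\<close>.
\<close>

lemma contraction_sqrt_unique:
  assumes C: "positive_contraction C" "\<And>x. A (C x) = C (A x)" and sq: "\<And>x. C (C x) = A (A x)"
  shows "C x = A x"
proof -
  define d where "d x = A x - C x" for x
  have lin: "linear A" "linear C" using A C by (auto simp: positive_contraction_def)
  have "inner (A (d x)) (d x) + inner (C (d x)) (d x) = inner (A (d x) + C (d x)) (d x)"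
    by (simp add: inner_add_left)
  also have "A (d x) + C (d x) = 0" by (simp add: d_def linear_diff lin C sq)
  finally have sum0: "inner (A (d x)) (d x) + inner (C (d x)) (d x) = 0" by simp
  moreover have "0 \<le> inner (A (d x)) (d x)" "0 \<le> inner (C (d x)) (d x)"
    using A C by (auto simp: positive_contraction_def)
  ultimately have "inner (A (d x)) (d x) = 0" "inner (C (d x)) (d x) = 0" by auto
  then have "A (d x) = 0" "C (d x) = 0"
    using positive_contraction_image_bound[OF A, of "d x"] positive_contraction_image_bound[OF C(1), of "d x"]
    by auto
  then have "inner (d x) (d x) = 0"
    using A C unfolding positive_contraction_def by (metis d_def inner_diff_left inner_commute inner_zero_left diff_self)
  then show ?thesis by (simp add: d_def)
qed

end

section \<open>Operators given by a pair of commuting maps\<close>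

text \<open>
  The operator \<open>G F\<^sup>-\<^sup>1\<close> with domain the range of \<open>F\<close>. Describing an unbounded operator by two bounded
  maps turns statements about its graph into identities between these maps.
\<close>

definition quotient_operator :: "('h \<Rightarrow> 'h) \<Rightarrow> ('h \<Rightarrow> 'h) \<Rightarrow> ('h \<rightharpoonup> 'h)" where
  "quotient_operator F G = (\<lambda>y. if y \<in> range F then Some (G (inv F y)) else None)"

lemma dom_quotient_operator: "dom (quotient_operator F G) = range F"
  by (auto simp: quotient_operator_def dom_def)

lemma quotient_operator_apply: "inj F \<Longrightarrow> quotient_operator F G (F x) = Some (G x)"
  by (simp add: quotient_operator_def)

lemma quotient_operator_eq_Some_iff:
  "inj F \<Longrightarrow> quotient_operator F G y = Some z \<longleftrightarrow> (\<exists>x. y = F x \<and> z = G x)"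
  by (auto simp: quotient_operator_def)

lemma (in hilbert_space) linear_operator_quotient:
  assumes "inj F" "linear F" "linear G"
    and "\<And>c x. F (smul c x) = smul c (F x)" and "\<And>c x. G (smul c x) = smul c (G x)"
  shows "linear_operator smul (quotient_operator F G)"
proof -
  have "subspace (range F)"
  proof (rule subspaceI)
    show "0 \<in> range F" by (metis assms(2) linear_0 rangeI)
    show "x + y \<in> range F" if "x \<in> range F" "y \<in> range F" for x y
      using that by (auto simp flip: linear_add[OF assms(2)])
    show "smul c x \<in> range F" if "x \<in> range F" for c x
      using that by (auto simp flip: assms(4))
  qed
  then show ?thesis
    unfolding linear_operator_def dom_quotient_operator
    by (auto simp: assms(1) quotient_operator_apply linear_add assms(3)
        simp flip: linear_add[OF assms(2)] assms(4))
       (auto simp: assms quotient_operator_apply)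
qed

text \<open>
  By symmetry of \<open>F\<close> and \<open>G\<close>, the pair \<open>(y, z)\<close> belongs to the adjoint exactly when \<open>G y = F z\<close>; the
  assumption \<open>factor\<close> says that such a pair lies on the graph.
\<close>

lemma self_adjoint_quotient:
  assumes F: "linear F" "inj F" "\<And>x y. inner (F x) y = inner x (F y)"
    and G: "linear G" "\<And>x y. inner (G x) y = inner x (G y)"
    and comm: "\<And>x. F (G x) = G (F x)"
    and factor: "\<And>y z. G y = F z \<Longrightarrow> \<exists>w. y = F w \<and> z = G w"
  shows "self_adjoint scaleR inner (quotient_operator F G)"
  unfolding real_self_adjoint_iff
proof (intro conjI allI)
  show "linear_operator scaleR (quotient_operator F G)"
    by (rule hilbert_space.linear_operator_quotient[OF hilbert_space_real])
      (simp_all add: F(1,2) G(1) linear_scale)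
  show "closure (dom (quotient_operator F G)) = UNIV"
    unfolding dom_quotient_operator using F by (rule dense_range_symmetric)
  show "quotient_operator F G y = Some z \<longleftrightarrow>
      (\<forall>x\<in>dom (quotient_operator F G). inner (the (quotient_operator F G x)) y = inner x z)" for y z
  proof -
    have "(\<forall>x\<in>dom (quotient_operator F G). inner (the (quotient_operator F G x)) y = inner x z)
        \<longleftrightarrow> (\<forall>u. inner (G u) y = inner (F u) z)"
      by (simp add: dom_quotient_operator quotient_operator_apply F(2))
    also have "\<dots> \<longleftrightarrow> G y = F z"
      unfolding F(3) G(2) by (rule vector_eq_ldot)
    also have "\<dots> \<longleftrightarrow> (\<exists>w. y = F w \<and> z = G w)"
      using factor comm by auto
    finally show ?thesis by (simp add: quotient_operator_eq_Some_iff F(2))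
  qed
qed

lemma self_adjoint_graph:
  assumes "self_adjoint scaleR inner S"
  shows "S y = Some z \<longleftrightarrow> (\<forall>u w. S u = Some w \<longrightarrow> inner w y = inner u z)"
proof -
  have "S y = Some z \<longleftrightarrow> (\<forall>u\<in>dom S. inner (the (S u)) y = inner u z)"
    using assms unfolding real_self_adjoint_iff by blast
  also have "\<dots> \<longleftrightarrow> (\<forall>u w. S u = Some w \<longrightarrow> inner w y = inner u z)"
    by (metis domD domI option.sel)
  finally show ?thesis .
qed

lemma map_eqI: "(\<And>x y. S x = Some y \<longleftrightarrow> T x = Some y) \<Longrightarrow> S = T"
  by (rule ext) (metis not_None_eq)

text \<open>
  Passing to adjoints reverses inclusions, so a self-adjoint operator has no proper self-adjoint
  extension.
\<close>

lemma self_adjoint_eqI: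
  assumes S: "self_adjoint scaleR inner S" and T: "self_adjoint scaleR inner T"
    and le: "\<And>x y. S x = Some y \<Longrightarrow> T x = Some y"
  shows "S = T"
proof (rule map_eqI, rule iffI)
  fix x y assume "T x = Some y"
  then have "inner w x = inner u y" if "S u = Some w" for u w
    using le[OF that] self_adjoint_graph[OF T] by blast
  then show "S x = Some y" using self_adjoint_graph[OF S] by blast
qed (rule le)

section \<open>The square root of an operator with given resolvent\<close>

text \<open>
  The map \<open>B\<close> plays the role of \<open>(1 + T)\<^sup>-\<^sup>1\<close> for the operator \<open>T\<close> defined below, and \<open>S\<close> is the
  square root of \<open>T\<close>.
\<close>

locale injective_contraction =
  fixes B :: "'h::{real_inner,complete_space} \<Rightarrow> 'h"
  assumes B: "positive_contraction B" and inj_B: "inj B"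
begin

definition "P = contraction_sqrt B"
definition "Q = contraction_sqrt (\<lambda>x. x - B x)"
definition "T = quotient_operator B (\<lambda>x. x - B x)"
definition "S = quotient_operator P Q"

lemmas B' = positive_contraction_complement[OF B]

lemma P: "positive_contraction P" and Q: "positive_contraction Q"
  unfolding P_def Q_def by (intro positive_contraction_sqrt B B')+

lemma P_P: "P (P x) = B x" and Q_Q: "Q (Q x) = x - B x"
  unfolding P_def Q_def by (simp_all add: contraction_sqrt_square B B')

lemma commute_sqrt:
  assumes "bounded_linear Z" "\<And>x. Z (B x) = B (Z x)"
  shows "Z (P x) = P (Z x)" and "Z (Q x) = Q (Z x)"
proof -
  show "Z (P x) = P (Z x)"
    unfolding P_def by (rule contraction_sqrt_commute[OF B assms])
  show "Z (Q x) = Q (Z x)"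
    unfolding Q_def
    by (rule contraction_sqrt_commute[OF B' assms(1)])
      (simp add: linear_diff[OF bounded_linear.linear[OF assms(1)]] assms(2))
qed

lemma P_B: "P (B x) = B (P x)" and Q_B: "Q (B x) = B (Q x)"
  using commute_sqrt[OF bounded_linear_positive_contraction[OF B]] by auto

lemma P_Q: "P (Q x) = Q (P x)"
  using commute_sqrt(2)[OF bounded_linear_positive_contraction[OF P] P_B] .

lemmas linearB = positive_contractionD(1)[OF B]
  and linearP = positive_contractionD(1)[OF P]
  and linearQ = positive_contractionD(1)[OF Q]
lemmas linears = linear_add[OF linearB] linear_add[OF linearP] linear_add[OF linearQ]
  linear_diff[OF linearB] linear_diff[OF linearP] linear_diff[OF linearQ]

lemma inj_P: "inj P"
  by (metis P_P inj_B injD injI)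

text \<open>
  The projection of \<open>(y, z)\<close> onto the graph of \<open>S\<close> is \<open>(P w, Q w)\<close> with \<open>w = P y + Q z\<close>; the
  hypothesis says that \<open>(y, z)\<close> is orthogonal to the orthogonal complement of the graph.
\<close>

lemma factor_PQ:
  assumes "Q y = P z"
  shows "\<exists>w. y = P w \<and> z = Q w"
proof (intro exI conjI)
  show "y = P (P y + Q z)"
    by (simp add: linears P_Q P_P Q_Q flip: assms)
  show "z = Q (P y + Q z)"
    by (simp add: linears Q_Q assms P_P flip: P_Q)
qed

lemma inner_B: "inner (B v) w = inner (P v) (P w)"
  by (simp only: P_P[symmetric] positive_contractionD(2)[OF P])

lemma dense_range_P: "closure (range P) = UNIV"
  by (rule dense_range_symmetric[OF linearP inj_P positive_contractionD(2)[OF P]])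

lemma self_adjoint_S: "self_adjoint scaleR inner S"
  unfolding S_def
  by (rule self_adjoint_quotient)
    (fact linearP linearQ inj_P P_Q factor_PQ positive_contractionD(2)[OF P] positive_contractionD(2)[OF Q])+

lemma self_adjoint_T: "self_adjoint scaleR inner T"
  unfolding T_def
proof (rule self_adjoint_quotient)
  show "\<exists>w. y = B w \<and> z = w - B w" if "y - B y = B z" for y z
    using that by (intro exI[of _ "y + z"]) (simp add: linears flip: that)
qed (fact linearB inj_B positive_contractionD(2)[OF B] positive_contractionD(1,2)[OF B']
    | simp add: linears)+

lemma positive_S: "positive_operator inner S"
proof -
  have "0 \<le> inner (Q x) (P x)" for x
    using positive_commuting_product[OF P Q P_Q, of x] by (simp only: positive_contractionD(2)[OF P])
  then show ?thesis
    by (auto simp: positive_operator_def S_def dom_quotient_operator quotient_operator_apply inj_P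
        real_nonneg_Reals_iff)
qed

lemma positive_T: "positive_operator inner T"
proof -
  have "0 \<le> inner (x - B x) (B x)" for x
    using positive_commuting_product[OF B B', of x]
    by (simp add: linears flip: positive_contractionD(2)[OF B])
  then show ?thesis
    by (auto simp: positive_operator_def T_def dom_quotient_operator quotient_operator_apply inj_B
        real_nonneg_Reals_iff)
qed

lemma S_Some_iff: "S y = Some z \<longleftrightarrow> (\<exists>x. y = P x \<and> z = Q x)"
  unfolding S_def by (rule quotient_operator_eq_Some_iff[OF inj_P])

lemma T_Some_iff: "T y = Some z \<longleftrightarrow> (\<exists>x. y = B x \<and> z = x - B x)"
  unfolding T_def by (rule quotient_operator_eq_Some_iff[OF inj_B])

lemma S_S: "S \<circ>\<^sub>m S = T"
proof -
  have "(S \<circ>\<^sub>m S) y = Some z \<longleftrightarrow> T y = Some z" for y z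
  proof
    assume "(S \<circ>\<^sub>m S) y = Some z"
    then obtain x w where "y = P x" "Q x = P w" "z = Q w"
      unfolding map_comp_Some_iff S_Some_iff by blast
    moreover from this obtain v where "x = P v" "w = Q v" using factor_PQ by blast
    ultimately show "T y = Some z" unfolding T_Some_iff by (auto simp: P_P Q_Q)
  next
    assume "T y = Some z"
    then obtain v where "y = P (P v)" "z = Q (Q v)" unfolding T_Some_iff by (auto simp: P_P Q_Q)
    then show "(S \<circ>\<^sub>m S) y = Some z"
      unfolding map_comp_Some_iff S_Some_iff
      by (intro exI[of _ "Q (P v)"] conjI exI[of _ "P v"] exI[of _ "Q v"]) (simp_all add: P_Q)
  qed
  then show ?thesis by (rule map_eqI)
qed

text \<open>
  The operator \<open>E = S' B\<close> is bounded because the range of \<open>B\<close> is the domain of \<open>S' S'\<close>. Every vector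
  splits as \<open>y = B y + S' (E y)\<close>, which reduces symmetry and positivity of \<open>E\<close> on the whole space to those
  of \<open>S'\<close> on its domain.
\<close>

lemma S_unique:
  assumes sa: "self_adjoint scaleR inner S'" and pos: "positive_operator inner S'"
    and sq: "S' \<circ>\<^sub>m S' = T"
  shows "S' = S"
proof -
  have S'_iff: "S' y = Some z \<longleftrightarrow> (\<forall>u w. S' u = Some w \<longrightarrow> inner w y = inner u z)" for y z
    by (rule self_adjoint_graph[OF sa])
  have S'_sym: "inner w y = inner u z" if "S' u = Some w" "S' y = Some z" for u w y z
    using S'_iff that by blast
  have S'_pos: "0 \<le> inner z y" if "S' y = Some z" for y z
    using pos that unfolding positive_operator_def real_nonneg_Reals_iff by (metis domI option.sel)
  \<comment> \<open>The graph of \<open>S'\<close>; it is closed because \<open>S'\<close> is its own adjoint.\<close>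
  define G where "G = {p. S' (fst p) = Some (snd p)}"
  have G_iff: "p \<in> G \<longleftrightarrow> S' (fst p) = Some (snd p)" for p by (simp add: G_def)
  have "G = (\<Inter>(u, w)\<in>{(u, w). S' u = Some w}. {p. inner w (fst p) = inner u (snd p)})"
    by (rule set_eqI) (subst G_iff, subst S'_iff, blast)
  moreover have "closed {p. inner w (fst p) = inner u (snd p)}" for u w :: 'h
    by (intro closed_Collect_eq continuous_intros)
  ultimately have closed_G: "closed G" by auto
  have S'_add: "S' (y + y') = Some (z + z')" if "S' y = Some z" "S' y' = Some z'" for y y' z z'
    unfolding S'_iff[of "y + y'"] inner_add_right using S'_sym[OF _ that(1)] S'_sym[OF _ that(2)] by metis
  have S'_scale: "S' (c *\<^sub>R y) = Some (c *\<^sub>R z)" if "S' y = Some z" for c y z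
    unfolding S'_iff[of "c *\<^sub>R y"] inner_scaleR_right using S'_sym[OF _ that] by metis
  have S'_diff: "S' (y - y') = Some (z - z')" if "S' y = Some z" "S' y' = Some z'" for y y' z z'
    using S'_add[OF that(1) S'_scale[OF that(2), of "-1"]] by simp

  define E where "E x = the (S' (B x))" for x
  have "\<exists>e. S' (B x) = Some e \<and> S' e = Some (x - B x)" for x
  proof -
    have "(S' \<circ>\<^sub>m S') (B x) = Some (x - B x)" unfolding sq T_Some_iff by blast
    then show ?thesis unfolding map_comp_Some_iff .
  qed
  then have E1: "S' (B x) = Some (E x)" and E2: "S' (E x) = Some (x - B x)" for x
    unfolding E_def by (metis option.sel)+
  \<comment> \<open>The map \<open>B\<close> is the inverse of \<open>1 + S' S'\<close>.\<close>
  have eq_B: "y = B (y + w)" if "S' y = Some z" "S' z = Some w" for y z w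
  proof -
    have "T y = Some w" using that unfolding sq[symmetric] map_comp_Some_iff by blast
    then show ?thesis unfolding T_Some_iff by auto
  qed
  \<comment> \<open>The operator \<open>S'\<close> commutes with \<open>B\<close>, because \<open>1 + S' S'\<close> maps \<open>E y\<close> to \<open>z\<close>.\<close>
  have S'_B: "E y = B z" if "S' y = Some z" for y z
    using eq_B[OF E2 S'_diff[OF that E1]] by simp
  have E_B: "E (B x) = B (E x)" for x by (rule S'_B[OF E1])
  have E_E: "E (E x) = B (x - B x)" for x by (rule S'_B[OF E2])

  have E_linear: "linear E"
  proof (rule linearI)
    show "E (x + y) = E x + E y" for x y
      using S'_add[OF E1 E1] by (simp add: E_def[of "x + y"] linears)
    show "E (c *\<^sub>R x) = c *\<^sub>R E x" for c x
      using S'_scale[OF E1] by (simp add: E_def[of "c *\<^sub>R x"] linear_scale[OF linearB])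
  qed
  have E_sym: "inner (E x) y = inner x (E y)" for x y
  proof -
    have "inner (E x) y = inner (E x) (B y) + inner (E x) (y - B y)" by (simp add: inner_diff_right)
    also have "inner (E x) (B y) = inner (B x) (E y)" by (rule S'_sym[OF E1 E1])
    also have "inner (E x) (y - B y) = inner (x - B x) (E y)" by (rule S'_sym[OF E2 E2, symmetric])
    finally show ?thesis by (simp add: inner_diff_left)
  qed
  have E_pos: "0 \<le> inner (E x) x" for x
    using S'_pos[OF E1, of x] S'_pos[OF E2, of x] by (simp add: inner_diff inner_commute)
  have "norm (E x) \<le> norm x" for x
  proof (rule power2_le_imp_le)
    have "(norm (E x))\<^sup>2 = inner (B x) (x - B x)"
      unfolding power2_norm_eq_inner by (rule S'_sym[OF E1 E2])
    also have "\<dots> \<le> inner (B x) x" by (simp add: inner_diff_right)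
    also have "\<dots> \<le> (norm x)\<^sup>2"
      unfolding power2_norm_eq_inner by (rule positive_contractionD(4)[OF B])
    finally show "(norm (E x))\<^sup>2 \<le> (norm x)\<^sup>2" .
  qed simp
  then have pc_E: "positive_contraction E"
    using E_linear E_sym E_pos by (intro positive_contractionI)

  have pc_PQ: "positive_contraction (\<lambda>x. P (Q x))"
  proof (rule positive_contractionI)
    show "linear (\<lambda>x. P (Q x))" using linear_compose[OF linearQ linearP] by (simp add: comp_def)
    show "inner (P (Q x)) y = inner x (P (Q y))" for x y
      by (simp only: positive_contractionD(2)[OF P] positive_contractionD(2)[OF Q] P_Q)
    show "0 \<le> inner (P (Q x)) x" for x by (rule positive_commuting_product[OF P Q P_Q])
    show "norm (P (Q x)) \<le> norm x" for x
      using norm_positive_contraction_le[OF P] norm_positive_contraction_le[OF Q] order_trans by blast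
  qed
  note E_sqrt = commute_sqrt[OF bounded_linear_positive_contraction[OF pc_E] E_B]
  \<comment> \<open>Both squares are \<open>B (1 - B)\<close>.\<close>
  have E_eq: "E x = P (Q x)" for x
    by (rule contraction_sqrt_unique[OF pc_PQ pc_E])
      (simp_all add: E_sqrt E_E P_Q P_P Q_Q linears flip: P_B Q_B)
  have "(P x, Q x) \<in> G" for x
  proof -
    have "x \<in> closure (range P)" by (simp add: dense_range_P)
    then obtain v where v: "\<And>n. v n \<in> range P" "v \<longlonglongrightarrow> x"
      unfolding closure_sequential by blast
    have "(P (v n), Q (v n)) \<in> G" for n
    proof -
      obtain u where "v n = P u" using v(1) by blast
      then show ?thesis using E1[of u] by (simp add: G_iff P_P E_eq P_Q)
    qed
    moreover have "(\<lambda>n. (P (v n), Q (v n))) \<longlonglongrightarrow> (P x, Q x)"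
      by (rule tendsto_Pair[OF
          bounded_linear.tendsto[OF bounded_linear_positive_contraction[OF P] v(2)]
          bounded_linear.tendsto[OF bounded_linear_positive_contraction[OF Q] v(2)]])
    ultimately show ?thesis by (rule closed_sequentially[OF closed_G])
  qed
  then have "S' y = Some z" if "S y = Some z" for y z
    using that unfolding S_Some_iff G_iff by auto
  then show ?thesis by (rule self_adjoint_eqI[OF self_adjoint_S sa, symmetric])
qed

end

section \<open>The resolvent of a closed form\<close>

lemma double_sequence_tendsto_0_le:
  fixes f g :: "nat \<Rightarrow> nat \<Rightarrow> real"
  assumes "((\<lambda>(n, m). g n m) \<longlongrightarrow> 0) (sequentially \<times>\<^sub>F sequentially)"
    and "\<And>n m. 0 \<le> f n m" and "\<And>n m. f n m \<le> g n m"
  shows "((\<lambda>(n, m). f n m) \<longlongrightarrow> 0) (sequentially \<times>\<^sub>F sequentially)"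
proof (rule tendsto_sandwich[OF _ _ tendsto_const assms(1)])
  show "\<forall>\<^sub>F p in sequentially \<times>\<^sub>F sequentially. 0 \<le> (\<lambda>(n, m). f n m) p"
    using assms(2) by (intro always_eventually) auto
  show "\<forall>\<^sub>F p in sequentially \<times>\<^sub>F sequentially. (\<lambda>(n, m). f n m) p \<le> (\<lambda>(n, m). g n m) p"
    using assms(3) by (intro always_eventually) auto
qed

text \<open>
  Closedness of \<open>s\<close> is completeness of \<open>D\<close> for the energy product \<open>s g h + inner g h\<close>.
\<close>

locale closed_real_form = real_form +
  assumes closed: "closed_form D s" and dense: "closure D = UNIV"
begin

sublocale energy: real_form D "\<lambda>g h. s g h + inner g h"
  by (rule real_formI)
    (simp_all add: subspace expand nonneg inner_add_left algebra_simps, metis sym inner_commute)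

lemma closedD:
  assumes "\<And>n. g n \<in> D" "g \<longlonglongrightarrow> b"
    and "((\<lambda>(n, m). s (g n - g m) (g n - g m)) \<longlongrightarrow> 0) (sequentially \<times>\<^sub>F sequentially)"
  shows "b \<in> D" and "(\<lambda>n. s (g n - b) (g n - b)) \<longlonglongrightarrow> 0"
  using closed assms unfolding closed_form_def by blast+

lemma energy_converges:
  assumes g: "\<And>n. g n \<in> D"
    and cauchy: "((\<lambda>(n, m). s (g n - g m) (g n - g m) + inner (g n - g m) (g n - g m)) \<longlongrightarrow> 0)
      (sequentially \<times>\<^sub>F sequentially)"
  shows "\<exists>b\<in>D. g \<longlonglongrightarrow> b \<and> (\<forall>h\<in>D. (\<lambda>n. s (g n) h + inner (g n) h) \<longlonglongrightarrow> s b h + inner b h)"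
proof -
  have nn: "0 \<le> s (g n - g m) (g n - g m)" for n m by (intro nonneg closed_ops g)
  have "Cauchy g"
    by (intro Cauchy_if_inner_tendsto_0 double_sequence_tendsto_0_le[OF cauchy])
      (use nn in simp_all)
  then obtain b where b: "g \<longlonglongrightarrow> b" using Cauchy_convergent convergent_def by blast
  have "((\<lambda>(n, m). s (g n - g m) (g n - g m)) \<longlongrightarrow> 0) (sequentially \<times>\<^sub>F sequentially)"
    by (rule double_sequence_tendsto_0_le[OF cauchy]) (use nn in simp_all)
  note closed = closedD[OF g b this]
  have "(\<lambda>n. s (g n) h + inner (g n) h) \<longlonglongrightarrow> s b h + inner b h" if "h \<in> D" for h
    by (intro tendsto_add tendsto_inner b tendsto_const form_tendsto g closed that)
  with closed(1) b show ?thesis by blast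
qed

lemma resolvent_exists: "\<exists>b\<in>D. \<forall>h\<in>D. s b h + inner b h = inner v h"
proof -
  have "(inner v h)\<^sup>2 \<le> (norm v)\<^sup>2 * (s h h + inner h h)" if "h \<in> D" for h
  proof -
    have "(inner v h)\<^sup>2 \<le> (norm v)\<^sup>2 * inner h h"
      unfolding power2_norm_eq_inner by (rule Cauchy_Schwarz_ineq)
    also have "\<dots> \<le> (norm v)\<^sup>2 * (s h h + inner h h)"
      using nonneg[OF that] by (intro mult_left_mono) auto
    finally show ?thesis .
  qed
  then obtain g where g: "\<And>n. g n \<in> D"
    and cauchy: "((\<lambda>(n, m). s (g n - g m) (g n - g m) + inner (g n - g m) (g n - g m)) \<longlongrightarrow> 0)
      (sequentially \<times>\<^sub>F sequentially)"
    and weak: "\<And>h. h \<in> D \<Longrightarrow> (\<lambda>n. s (g n) h + inner (g n) h) \<longlonglongrightarrow> inner v h"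
    using energy.riesz_sequence[of "inner v" "(norm v)\<^sup>2"] by (auto simp: inner_add_right)
  obtain b where "b \<in> D" "g \<longlonglongrightarrow> b"
    and lim: "\<forall>h\<in>D. (\<lambda>n. s (g n) h + inner (g n) h) \<longlonglongrightarrow> s b h + inner b h"
    using energy_converges[OF g cauchy] by blast
  have "s b h + inner b h = inner v h" if "h \<in> D" for h
    by (rule LIMSEQ_unique[OF bspec[OF lim that] weak[OF that]])
  with \<open>b \<in> D\<close> show ?thesis by blast
qed

definition resolvent where
  "resolvent v = (SOME b. b \<in> D \<and> (\<forall>h\<in>D. s b h + inner b h = inner v h))"

lemma resolvent_in: "resolvent v \<in> D"
  and resolvent_eq: "h \<in> D \<Longrightarrow> s (resolvent v) h + inner (resolvent v) h = inner v h"
  using someI_ex[OF resolvent_exists[of v, unfolded Bex_def]] unfolding resolvent_def by blast+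

lemma resolvent_unique:
  assumes "b \<in> D" and "\<And>h. h \<in> D \<Longrightarrow> s b h + inner b h = inner v h"
  shows "resolvent v = b"
proof -
  let ?d = "resolvent v - b"
  have d: "?d \<in> D" by (intro closed_ops resolvent_in assms)
  have "s ?d ?d + inner ?d ?d = (s (resolvent v) ?d + inner (resolvent v) ?d) - (s b ?d + inner b ?d)"
    by (simp only: diff_left[OF resolvent_in assms(1) d] inner_diff_left)
  also have "\<dots> = 0" by (simp only: resolvent_eq[OF d] assms(2)[OF d] diff_self)
  finally have "inner ?d ?d = 0" using nonneg[OF d] inner_ge_zero[of ?d] by linarith
  then have "?d = 0" by (simp only: inner_eq_zero_iff)
  then show ?thesis by simp
qed

lemma resolvent_linear: "linear resolvent"
proof (rule linearI)
  show "resolvent (x + y) = resolvent x + resolvent y" for x y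
  proof (rule resolvent_unique)
    show "s (resolvent x + resolvent y) h + inner (resolvent x + resolvent y) h = inner (x + y) h"
      if "h \<in> D" for h
      using resolvent_eq[OF that, of x] resolvent_eq[OF that, of y] that
      by (simp add: resolvent_in add_left inner_add_left)
  qed (intro closed_ops resolvent_in)
  show "resolvent (c *\<^sub>R x) = c *\<^sub>R resolvent x" for c x
  proof (rule resolvent_unique)
    show "s (c *\<^sub>R resolvent x) h + inner (c *\<^sub>R resolvent x) h = inner (c *\<^sub>R x) h"
      if "h \<in> D" for h
      using that by (simp add: resolvent_in scale_left resolvent_eq flip: distrib_left)
  qed (intro closed_ops resolvent_in)
qed

text \<open>
  The form \<open>inner (B v) w\<close> is the energy product of \<open>B v\<close> and \<open>B w\<close>; symmetry and positivity of \<open>B\<close>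
  are inherited from it.
\<close>

lemma inner_resolvent:
  "inner (resolvent v) w = s (resolvent v) (resolvent w) + inner (resolvent v) (resolvent w)"
  using resolvent_eq[OF resolvent_in, of w v] sym[OF resolvent_in resolvent_in, of v w]
  by (simp add: inner_commute)

lemma positive_contraction_resolvent: "positive_contraction resolvent"
proof (rule positive_contractionI)
  show "inner (resolvent v) w = inner v (resolvent w)" for v w
    using inner_resolvent[of v w] resolvent_eq[OF resolvent_in, of v w] by simp
  show "0 \<le> inner (resolvent v) v" for v
    using inner_resolvent[of v v] nonneg[OF resolvent_in, of v] by simp
  show "norm (resolvent v) \<le> norm v" for v
  proof -
    have "norm (resolvent v) * norm (resolvent v) \<le> inner (resolvent v) v"
      using inner_resolvent[of v v] nonneg[OF resolvent_in, of v]
      by (simp add: dot_square_norm power2_eq_square)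
    also have "\<dots> \<le> norm (resolvent v) * norm v" by (rule norm_cauchy_schwarz)
    finally show ?thesis
      by (cases "resolvent v = 0") simp_all
  qed
qed (rule resolvent_linear)

lemma inj_resolvent: "inj resolvent"
proof (rule injI)
  fix v w assume eq: "resolvent v = resolvent w"
  have "inner h (v - w) = 0" if "h \<in> D" for h
    using resolvent_eq[OF that, of v] resolvent_eq[OF that, of w] eq
    by (simp add: inner_diff_right inner_commute)
  then show "v = w" using orthogonal_dense[OF dense] by fastforce
qed

sublocale injective_contraction resolvent
  by unfold_locales (rule positive_contraction_resolvent inj_resolvent)+

text \<open>
  The energy product of \<open>B v\<close> and \<open>g\<close> is \<open>inner v g\<close>, and the energy of \<open>B v\<close> is the squared norm of
  \<open>P v\<close>, so the Cauchy-Schwarz inequality is the bound required for membership in the range of \<open>P\<close>.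
\<close>

lemma domain_subset_range_P: "D \<subseteq> range P"
proof
  fix g assume g: "g \<in> D"
  let ?C = "s g g + inner g g"
  show "g \<in> range P"
  proof (rule range_if_bounded)
    show "(inner v g)\<^sup>2 \<le> ?C * (norm (P v))\<^sup>2" for v
    proof -
      have "(inner v g)\<^sup>2 \<le> (s (resolvent v) (resolvent v) + inner (resolvent v) (resolvent v)) * ?C"
        using energy.cauchy_schwarz[OF resolvent_in g, of v] by (simp only: resolvent_eq[OF g])
      also have "s (resolvent v) (resolvent v) + inner (resolvent v) (resolvent v) = (norm (P v))\<^sup>2"
        unfolding inner_resolvent[symmetric] power2_norm_eq_inner by (rule inner_B)
      finally show ?thesis by (simp only: mult.commute)
    qed
    show "0 \<le> ?C" by (rule energy.nonneg[OF g])
  qed (fact linearP positive_contractionD(2)[OF P])+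
qed

text \<open>
  Approximate \<open>x\<close> by vectors \<open>P w\<^sub>n\<close>. The vectors \<open>B w\<^sub>n = P (P w\<^sub>n)\<close> lie in \<open>D\<close>, converge to \<open>P x\<close>, and are
  Cauchy in energy because their energy distances are the distances of the \<open>P w\<^sub>n\<close>.
\<close>

lemma P_in_domain: "P x \<in> D"
  and energy_P_P: "s (P x) (P y) + inner (P x) (P y) = inner x y"
proof -
  have in_and_eq: "P x \<in> D \<and> (\<forall>h\<in>D. \<forall>y. h = P y \<longrightarrow> s (P x) h + inner (P x) h = inner x y)" for x
  proof -
    have "x \<in> closure (range P)" by (simp add: dense_range_P)
    then obtain u where u: "\<And>n. u n \<in> range P" "u \<longlonglongrightarrow> x"
      unfolding closure_sequential by blast
    have "\<forall>n. \<exists>w. u n = P w" using u(1) by blast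
    then obtain w where w: "\<And>n. u n = P (w n)" by metis
    let ?g = "\<lambda>n. resolvent (w n)"
    have g_lim: "?g \<longlonglongrightarrow> P x"
      using bounded_linear.tendsto[OF bounded_linear_positive_contraction[OF P] u(2)]
      by (simp add: w P_P)
    have "s (?g n - ?g m) (?g n - ?g m) + inner (?g n - ?g m) (?g n - ?g m)
        = inner (u n - u m) (u n - u m)" for n m
      unfolding linear_diff[OF linearB, symmetric] inner_resolvent[symmetric]
        w linear_diff[OF linearP, symmetric] by (rule inner_B)
    moreover have "((\<lambda>(n, m). inner (u n - u m) (u n - u m)) \<longlongrightarrow> 0) (sequentially \<times>\<^sub>F sequentially)"
      unfolding double_sequence_tendsto_0
    proof safe
      fix e :: real assume "e > 0"
      then obtain N where N: "\<forall>n\<ge>N. \<forall>m\<ge>N. norm (u n - u m) < sqrt e"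
        using CauchyD[OF LIMSEQ_imp_Cauchy[OF u(2)], of "sqrt e"] by auto
      have "\<bar>inner (u n - u m) (u n - u m)\<bar> < e" if "n \<ge> N" "m \<ge> N" for n m
        using N that by (simp add: norm_eq_sqrt_inner)
      then show "\<exists>N. \<forall>n\<ge>N. \<forall>m\<ge>N. \<bar>inner (u n - u m) (u n - u m)\<bar> < e" by blast
    qed
    ultimately have cauchy: "((\<lambda>(n, m). s (?g n - ?g m) (?g n - ?g m) + inner (?g n - ?g m) (?g n - ?g m)) \<longlongrightarrow> 0)
      (sequentially \<times>\<^sub>F sequentially)" by simp
    obtain b where b: "b \<in> D" "?g \<longlonglongrightarrow> b"
      and weak: "\<forall>h\<in>D. (\<lambda>n. s (?g n) h + inner (?g n) h) \<longlonglongrightarrow> s b h + inner b h"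
      using energy_converges[OF resolvent_in cauchy] by blast
    have b_eq: "b = P x" by (rule LIMSEQ_unique[OF b(2) g_lim])
    have "s (P x) h + inner (P x) h = inner x y" if "h \<in> D" "h = P y" for h y
    proof (rule LIMSEQ_unique)
      show "(\<lambda>n. s (?g n) h + inner (?g n) h) \<longlonglongrightarrow> s (P x) h + inner (P x) h"
        using bspec[OF weak that(1)] by (simp only: b_eq)
      have "s (?g n) h + inner (?g n) h = inner (u n) y" for n
        unfolding resolvent_eq[OF that(1)] w
        by (simp only: that(2) positive_contractionD(2)[OF P])
      then show "(\<lambda>n. s (?g n) h + inner (?g n) h) \<longlonglongrightarrow> inner x y"
        by (simp only:) (intro tendsto_inner u tendsto_const)
    qed
    then show ?thesis using b(1) b_eq by blast
  qed
  show "P x \<in> D" using in_and_eq by blast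
  show "s (P x) (P y) + inner (P x) (P y) = inner x y" using in_and_eq by blast
qed

lemma domain_eq_range_P: "D = range P"
  using domain_subset_range_P P_in_domain by blast

lemma form_P_P: "s (P x) (P y) = inner (Q x) (Q y)"
proof -
  have "inner (P x) (P y) + inner (Q x) (Q y) = inner x (P (P y) + Q (Q y))"
    by (simp only: positive_contractionD(2)[OF P] positive_contractionD(2)[OF Q] inner_add_right)
  also have "\<dots> = inner x y" by (simp add: P_P Q_Q)
  finally show ?thesis using energy_P_P[of x y] by linarith
qed

lemma dom_S: "dom S = D"
  by (simp add: S_def dom_quotient_operator flip: domain_eq_range_P)

lemma form_eq_S:
  assumes "g \<in> D" "h \<in> D"
  shows "s g h = inner (the (S g)) (the (S h))"
proof -
  obtain x y where "g = P x" "h = P y" using assms domain_subset_range_P by blast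
  then show ?thesis by (simp add: S_def quotient_operator_apply inj_P form_P_P)
qed

lemma dom_T_subset: "dom T \<subseteq> D"
  by (auto simp: T_def dom_quotient_operator resolvent_in)

lemma form_eq_T:
  assumes "g \<in> dom T" "h \<in> D"
  shows "s g h = inner (the (T g)) h"
proof -
  obtain x where "g = resolvent x" using assms(1) by (auto simp: T_def dom_quotient_operator)
  then show ?thesis
    using resolvent_eq[OF assms(2), of x]
    by (simp add: T_def quotient_operator_apply inj_resolvent inner_diff_left)
qed

text \<open>
  The representation property says that \<open>g\<close> solves the equation defining the resolvent of
  \<open>T' g + g\<close>, so \<open>T\<close> extends \<open>T'\<close>.
\<close>

lemma T_unique:
  assumes T': "self_adjoint scaleR inner T'" and sub: "dom T' \<subseteq> D"
    and rep: "\<And>g h. g \<in> dom T' \<Longrightarrow> h \<in> D \<Longrightarrow> s g h = inner (the (T' g)) h"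
  shows "T' = T"
proof (rule self_adjoint_eqI[OF T' self_adjoint_T])
  fix g z assume z: "T' g = Some z"
  then have g: "g \<in> dom T'" by auto
  then have "resolvent (z + g) = g"
    using sub rep[OF g] z by (intro resolvent_unique) (auto simp: inner_add_left)
  then show "T g = Some z" unfolding T_Some_iff by (metis add_diff_cancel_right')
qed

end

section \<open>The representation theorem\<close>

locale hilbert_space_form = hilbert_space smul ip
  for smul :: "'k::real_or_complex \<Rightarrow> 'h::{real_inner,complete_space} \<Rightarrow> 'h"
    and ip :: "'h \<Rightarrow> 'h \<Rightarrow> 'k" +
  fixes D :: "'h set" and t :: "'h \<Rightarrow> 'h \<Rightarrow> 'k"
  assumes form: "nonneg_symmetric_form smul D t"
    and closed: "closed_form D t" and dense: "closure D = UNIV"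
begin

lemma subspace_D: "subspace D"
  and t_add: "\<And>f g h. \<lbrakk>f \<in> D; g \<in> D; h \<in> D\<rbrakk> \<Longrightarrow> t (f + g) h = t f h + t g h"
  and t_scale: "\<And>c g h. \<lbrakk>g \<in> D; h \<in> D\<rbrakk> \<Longrightarrow> t (smul c g) h = c * t g h"
  and t_commute: "\<And>g h. \<lbrakk>g \<in> D; h \<in> D\<rbrakk> \<Longrightarrow> t g h = conjg (t h g)"
  and t_nonneg: "\<And>g. g \<in> D \<Longrightarrow> t g g \<in> \<real>\<^sub>\<ge>\<^sub>0"
  using form unfolding nonneg_symmetric_form_def by blast+

abbreviation "s g h \<equiv> re (t g h)"

lemma t_self: "g \<in> D \<Longrightarrow> t g g = of_real (s g g)"
  using t_nonneg[of g] unfolding nonneg_Reals_iff_re by (simp add: of_real_re_self_conjugate)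

sublocale closed_real_form D s
proof unfold_locales
  have "real_form D s"
  proof (rule real_formI)
    show "real_vector.subspace D" by (rule subspace_imp_real[OF subspace_D])
    show "s (c *\<^sub>R g) h = c * s g h" if "g \<in> D" "h \<in> D" for c g h
      using t_scale[OF that, of "of_real c"] by (simp add: scale_of_real re_of_real_mult)
    show "s g h = s h g" if "g \<in> D" "h \<in> D" for g h
      using t_commute[OF that] by simp
  qed (simp_all add: t_add re_add t_nonneg[unfolded nonneg_Reals_iff_re])
  then show "nonneg_symmetric_form scaleR D s" by (simp add: real_form_def)
  show "closed_form D s"
    unfolding closed_form_def
  proof (intro allI impI)
    fix gs g
    assume gs: "\<forall>n. gs n \<in> D" "gs \<longlonglongrightarrow> g"
      and cauchy: "((\<lambda>(n, m). s (gs n - gs m) (gs n - gs m)) \<longlongrightarrow> 0) (sequentially \<times>\<^sub>F sequentially)"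
    have diff: "gs n - h \<in> D" if "h \<in> D" for n h using gs(1) that subspace_diff[OF subspace_D] by blast
    have "(\<lambda>(n, m). t (gs n - gs m) (gs n - gs m)) =
        (\<lambda>p. of_real ((\<lambda>(n, m). s (gs n - gs m) (gs n - gs m)) p))"
      using gs(1) by (auto simp: fun_eq_iff intro!: t_self diff)
    then have "((\<lambda>(n, m). t (gs n - gs m) (gs n - gs m)) \<longlongrightarrow> 0) (sequentially \<times>\<^sub>F sequentially)"
      using tendsto_of_real[OF cauchy, where 'a='k] by simp
    then have g: "g \<in> D" and lim: "(\<lambda>n. t (gs n - g) (gs n - g)) \<longlonglongrightarrow> 0"
      using closed gs unfolding closed_form_def by blast+
    have "(\<lambda>n. t (gs n - g) (gs n - g)) = (\<lambda>n. of_real (s (gs n - g) (gs n - g)))"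
      by (rule ext) (rule t_self[OF diff[OF g]])
    then have "(\<lambda>n. of_real (s (gs n - g) (gs n - g)) :: 'k) \<longlonglongrightarrow> of_real 0"
      using lim by simp
    then show "g \<in> D \<and> (\<lambda>n. s (gs n - g) (gs n - g)) \<longlonglongrightarrow> 0"
      using g unfolding tendsto_of_real_iff by simp
  qed
qed (rule dense)

text \<open>
  The scalar \<open>c\<close> can be moved to the second argument of both \<open>t\<close> and the inner product, where it
  disappears into the test vector.
\<close>

lemma resolvent_scale: "resolvent (smul c x) = smul c (resolvent x)"
proof (rule resolvent_unique)
  show "smul c (resolvent x) \<in> D" by (rule subspace_scale[OF subspace_D resolvent_in])
  fix h assume h: "h \<in> D"
  have h': "smul (conjg c) h \<in> D" by (rule subspace_scale[OF subspace_D h])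
  have "t (resolvent x) (smul (conjg c) h) = c * t (resolvent x) h"
    using t_commute[OF resolvent_in h', of x] t_commute[OF resolvent_in h, of x]
    by (simp add: t_scale[OF h resolvent_in] conjg_mult)
  then have "s (smul c (resolvent x)) h = s (resolvent x) (smul (conjg c) h)"
    by (simp add: t_scale[OF resolvent_in h])
  then show "s (smul c (resolvent x)) h + inner (smul c (resolvent x)) h = inner (smul c x) h"
    using resolvent_eq[OF h', of x] by (simp only: inner_scale_left)
qed

lemma self_adjoint_T_S: "self_adjoint smul ip T" "self_adjoint smul ip S"
proof -
  note PQ = commute_sqrt[OF bounded_linear_scale resolvent_scale[symmetric], symmetric]
  have "linear_operator smul T" "linear_operator smul S"
    unfolding T_def S_def
    by (rule linear_operator_quotient inj_resolvent linearB positive_contractionD(1)[OF B']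
          resolvent_scale inj_P linearP linearQ PQ
        | simp add: resolvent_scale scale_right_diff_distrib)+
  then show "self_adjoint smul ip T" "self_adjoint smul ip S"
    unfolding self_adjoint_iff_real using self_adjoint_T self_adjoint_S by auto
qed

lemma sqrt_operator_T: "sqrt_operator smul ip T = S"
  unfolding sqrt_operator_def
proof (rule the_equality)
  show "self_adjoint smul ip S \<and> positive_operator ip S \<and> S \<circ>\<^sub>m S = T"
    using self_adjoint_T_S positive_S S_S by (simp add: positive_iff_real)
  show "S' = S" if "self_adjoint smul ip S' \<and> positive_operator ip S' \<and> S' \<circ>\<^sub>m S' = T" for S'
    using that by (intro S_unique) (auto simp: positive_iff_real self_adjoint_iff_real)
qed

lemma scalar_form_eqI:
  assumes "g \<in> D" "h \<in> D" and "\<And>c. s (smul c g) h = inner (smul c u) v"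
  shows "t g h = ip u v"
  by (rule scalar_eq_via_re) (simp only: t_scale[OF assms(1,2), symmetric] assms(3) re_scale_ip)

lemma linear_operator_scale:
  assumes "self_adjoint smul ip A" "g \<in> dom A"
  shows "smul c g \<in> dom A" and "the (A (smul c g)) = smul c (the (A g))"
proof -
  have "subspace (dom A)" and *: "\<forall>c. \<forall>x\<in>dom A. the (A (smul c x)) = smul c (the (A x))"
    using assms(1) unfolding self_adjoint_def linear_operator_def by blast+
  then show "smul c g \<in> dom A" by (intro subspace_scale assms(2))
  show "the (A (smul c g)) = smul c (the (A g))" using * assms(2) by blast
qed

lemma t_eq_T: "g \<in> dom T \<Longrightarrow> h \<in> D \<Longrightarrow> t g h = ip (the (T g)) h"
  using dom_T_subset linear_operator_scale[OF self_adjoint_T_S(1)]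
  by (intro scalar_form_eqI) (auto simp: form_eq_T simp del: domIff)

lemma t_eq_S: "g \<in> D \<Longrightarrow> h \<in> D \<Longrightarrow> t g h = ip (the (S g)) (the (S h))"
  using linear_operator_scale[OF self_adjoint_T_S(2)] unfolding dom_S
  by (intro scalar_form_eqI) (auto simp: form_eq_S)

lemma representing_operator_unique:
  assumes "self_adjoint smul ip T'" "dom T' \<subseteq> D"
    and "\<And>g h. g \<in> dom T' \<Longrightarrow> h \<in> D \<Longrightarrow> t g h = ip (the (T' g)) h"
  shows "T' = T"
  using assms by (intro T_unique) (simp_all add: self_adjoint_iff_real re_ip)

end

theorem corollary2p7:
  fixes smul :: "'k::real_or_complex \<Rightarrow> 'h::{real_inner,complete_space} \<Rightarrow> 'h"
    and ip :: "'h \<Rightarrow> 'h \<Rightarrow> 'k"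
    and D :: "'h set"
    and t :: "'h \<Rightarrow> 'h \<Rightarrow> 'k"
  assumes "hilbert_space smul ip"
    and "nonneg_symmetric_form smul D t"
    and "closed_form D t"
    and "closure D = UNIV"
  shows "\<exists>!T :: 'h \<rightharpoonup> 'h.
    self_adjoint smul ip T \<and> positive_operator ip T \<and>
    (dom T \<subseteq> D \<and> (\<forall>g\<in>dom T. \<forall>h\<in>D. t g h = ip (the (T g)) h)) \<and>
    (D = dom (sqrt_operator smul ip T) \<and>
     (\<forall>g\<in>D. \<forall>h\<in>D.
        t g h = ip (the (sqrt_operator smul ip T g)) (the (sqrt_operator smul ip T h))))"
proof -
  interpret hilbert_space_form smul ip D t
    using assms by (simp add: hilbert_space_form_def hilbert_space_form_axioms_def)
  show ?thesis
  proof (rule ex1I[of _ T])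
    show "self_adjoint smul ip T \<and> positive_operator ip T \<and>
      (dom T \<subseteq> D \<and> (\<forall>g\<in>dom T. \<forall>h\<in>D. t g h = ip (the (T g)) h)) \<and>
      (D = dom (sqrt_operator smul ip T) \<and>
       (\<forall>g\<in>D. \<forall>h\<in>D.
          t g h = ip (the (sqrt_operator smul ip T g)) (the (sqrt_operator smul ip T h))))"
      unfolding sqrt_operator_T dom_S
      using self_adjoint_T_S(1) positive_T dom_T_subset t_eq_T t_eq_S
      by (simp add: positive_iff_real del: domIff)
    show "T' = T" if "self_adjoint smul ip T' \<and> positive_operator ip T' \<and>
      (dom T' \<subseteq> D \<and> (\<forall>g\<in>dom T'. \<forall>h\<in>D. t g h = ip (the (T' g)) h)) \<and>
      (D = dom (sqrt_operator smul ip T') \<and>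
       (\<forall>g\<in>D. \<forall>h\<in>D.
          t g h = ip (the (sqrt_operator smul ip T' g)) (the (sqrt_operator smul ip T' h))))" for T'
      using that by (intro representing_operator_unique) blast+
  qed
qed

end
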